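(* Let $\mathcal D\subset\mathbb R^d$ be a (not necessarily bounded) domain satisfying the standing assumptions described in the context, let $x_0\in\mathcal R$, let $(\xi_n)_{n\ge 0}$ be the random walk with reflection density $\bar\gamma$ started at $\xi_0=x_0$, and let $\tau_n$ be its $n$-th hitting time of the boundary. Then, with probability $1$, $\lim_{n\to\infty}\tau_n=+\infty$.
   Context: Notation: $d\ge 2$; $\|\cdot\|$ is the Euclidean norm, $\mathcal B(x,\varepsilon)$ the open ball, $\mathbb S^{d-1}$ the unit sphere, $e=(1,0,\dots,0)$, and $\mathbb S_v=\{w\in\mathbb S^{d-1}:v\cdot w>0\}$. On $\mathcal D$ we integrate with respect to Lebesgue measure, on $\mathbb S^{d-1}$ with respect to (unnormalized) surface measure, on $\partial\mathcal D$ with respect to $(d-1)$-dimensional Hausdorff measure. Standing assumptions on the domain: $\mathcal D\subset\mathbb R^d$ is open and connected, and (Lipschitz condition) for every $x\in\partial\mathcal D$ there exist $\varepsilon_x>0$, an affine isometry $\mathfrak I_x:\mathbb R^d\to\mathbb R^d$ with $\mathfrak I_x x=0$ and a Lipschitz function $f_x:\mathbb R^{d-1}\to\mathbb R$ with $f_x(0)=0$ such that $\mathfrak I_x(\mathcal D\cap\mathcal B(x,\varepsilon_x))=\{z\in\mathcal B(0,\varepsilon_x):z^{(d)}>f_x(z^{(1)},\dots,z^{(d-1)})\}$. Moreover there is a relatively open set $\tilde{\mathcal R}\subset\partial\mathcal D$, with $\partial\mathcal D\setminus\tilde{\mathcal R}$ of $(d-1)$-dimensional Hausdorff measure zero, such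 that $\partial\mathcal D$ has a local $C^1$ parametrization at each point of $\tilde{\mathcal R}$. For $x\in\tilde{\mathcal R}$, $\mathbf n(x)$ is the unit normal vector pointing into $\mathcal D$. Reflection law: $\bar\gamma$ is a probability density on $\mathbb S_e$ with $\inf_{u\in B}\bar\gamma(u)>0$ for every compact $B\subset\mathbb S_e$. $(U_x,x\in\partial\mathcal D)$ is a measurable family of orthogonal linear operators of $\mathbb R^d$ with $U_xe=\mathbf n(x)$ for all $x\in\tilde{\mathcal R}$. Case 1: $\bar\gamma(u)$ depends only on $u\cdot e$; then $\mathcal R:=\tilde{\mathcal R}$. Case 2: otherwise; then $x\mapsto U_x$ is assumed continuous at almost every $x\in\partial\mathcal D$ and $\mathcal R:=\{x\in\tilde{\mathcal R}: x\mapsto U_x\text{ is continuous at }x\}$. Process: for $x\in\tilde{\mathcal R},u\in\mathbb S_{\mathbf n(x)}$ or $x\in\mathcal D,u\in\mathbb S^{d-1}$ let $\mathsf r_x(u)=\inf\{t>0:x+tu\in\partial\mathcal D\}$ ($\inf\emptyset=+\infty$) and $\mathsf h_x(u)=x+u\,\mathsf r_x(u)\in\partial\mathcal D$ if $\mathsf r_x(u)<\infty$, $\mathsf h_x(u)=\infty$ otherwise. Let $\eta_0,\eta_1,\dots$ be i.i.d. with density $\bar\gamma$ on $\mathbb S_e$. Set $\xi_0=x_0$ and $\xi_{n+1}=\mathsf h_{\xi_n}(U_{\xi_n}\eta_n)$ if $\xi_n\in\mathcal R$, $\xi_{n+1}=\infty$ if $\xi_n=\infty$, and $\xi_{n+1}$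 undefined (a special cemetery state) otherwise; the last case has probability zero when $x_0\in\mathcal R$. Set $\tau_0=0$ and $\tau_n=\sum_{i=0}^{n-1}\mathsf r_{\xi_i}(U_{\xi_i}\eta_i)$, with $\tau_n=+\infty$ as soon as $\xi_n=\infty$. *)

theory Defs
  imports "HOL-Probability.Probability"
begin

text \<open>
  The index type is finite and linearly ordered, so that the first and the last coordinate make
  sense. The space of the first \<open>d - 1\<close> coordinates is identified with the hyperplane
  \<open>base_plane\<close> on which the last coordinate vanishes.
\<close>

type_synonym 'n rvec = "real ^ 'n"
type_synonym 'n sqmat = "real ^ 'n ^ 'n"

definition e_vec :: "'n::{finite,linorder} rvec" where
  "e_vec = axis (Min UNIV) 1"

definition last_coord :: "'n::{finite,linorder} rvec \<Rightarrow> real" where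
  "last_coord z = z $ Max UNIV"

definition base_plane :: "'n::{finite,linorder} rvec set" where
  "base_plane = {z. last_coord z = 0}"

definition base_proj :: "'n::{finite,linorder} rvec \<Rightarrow> 'n rvec" where
  "base_proj z = (\<chi> i. if i = Max UNIV then 0 else z $ i)"

definition half_sphere :: "'a::euclidean_space \<Rightarrow> 'a set" where
  "half_sphere v = {w \<in> sphere 0 1. v \<bullet> w > 0}"

text \<open>
  Surface measure on the unit sphere: a Borel set \<open>A\<close> of the sphere gets \<open>d\<close> times the Lebesgue
  measure of the cone \<open>{t u | 0 < t < 1, u \<in> A}\<close>. The centre, which \<open>sgn\<close> maps to \<open>0\<close>, is a null
  set, so the measure is carried by the sphere.
\<close>

definition sphere_measure :: "'a::euclidean_space measure" where
  "sphere_measure =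
     scale_measure (of_nat DIM('a)) (distr (restrict_space lborel (ball 0 1)) borel sgn)"

text \<open>
  The \<open>k\<close>-dimensional Hausdorff (outer) measure, for \<open>k \<ge> 1\<close>, normalised to agree with surface
  area. The covering sets are required to be bounded because \<open>diameter\<close> is meaningless otherwise.
\<close>

definition hausdorff_content :: "nat \<Rightarrow> real \<Rightarrow> 'a::metric_space set \<Rightarrow> ennreal" where
  "hausdorff_content k \<delta> A =
     (INF C \<in> {C :: nat \<Rightarrow> 'a set.
                A \<subseteq> (\<Union>i. C i) \<and> (\<forall>i. bounded (C i) \<and> diameter (C i) \<le> \<delta>)}.
        \<Sum>i. ennreal (unit_ball_vol (real k) * (diameter (C i) / 2) ^ k))"

definition hausdorff_measure :: "nat \<Rightarrow> 'a::metric_space set \<Rightarrow> ennreal" where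
  "hausdorff_measure k A = (SUP \<delta> \<in> {0<..}. hausdorff_content k \<delta> A)"

definition affine_isometry :: "('a::euclidean_space \<Rightarrow> 'a) \<Rightarrow> bool" where
  "affine_isometry J \<longleftrightarrow> (\<exists>T c. orthogonal_transformation T \<and> J = (\<lambda>y. T y + c))"

definition lipschitz_boundary :: "'n::{finite,linorder} rvec set \<Rightarrow> bool" where
  "lipschitz_boundary D \<longleftrightarrow>
     (\<forall>x \<in> frontier D. \<exists>\<epsilon>>0. \<exists>J f.
        affine_isometry J \<and> J x = 0 \<and>
        (\<exists>L. L-lipschitz_on base_plane f) \<and> f 0 = 0 \<and>
        J ` (D \<inter> ball x \<epsilon>) = {z \<in> ball 0 \<epsilon>. last_coord z > f (base_proj z)})"

text \<open>
  \<open>local_C1_param S x \<phi> \<phi>' p\<close>: on a relatively open subset of the hyperplane, \<open>\<phi>\<close> is a regular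
  \<open>C\<^sup>1\<close> parametrization, with derivative \<open>\<phi>'\<close>, of a neighbourhood of \<open>x = \<phi> p\<close> in \<open>S\<close>.
  Only the restriction of \<open>\<phi>' q\<close> to the hyperplane is determined by \<open>\<phi>\<close>.
\<close>

definition local_C1_param ::
  "'n::{finite,linorder} rvec set \<Rightarrow> 'n rvec \<Rightarrow> ('n rvec \<Rightarrow> 'n rvec) \<Rightarrow>
     ('n rvec \<Rightarrow> 'n rvec \<Rightarrow> 'n rvec) \<Rightarrow> 'n rvec \<Rightarrow> bool" where
  "local_C1_param S x \<phi> \<phi>' p \<longleftrightarrow>
     (\<exists>V W \<psi>. openin (top_of_set base_plane) V \<and> p \<in> V \<and> open W \<and> \<phi> p = x \<and>
        homeomorphism V (S \<inter> W) \<phi> \<psi> \<and>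
        (\<forall>q \<in> V. (\<phi> has_derivative \<phi>' q) (at q within V) \<and> inj_on (\<phi>' q) base_plane) \<and>
        (\<forall>h \<in> base_plane. continuous_on V (\<lambda>q. \<phi>' q h)))"

definition regular_boundary_part ::
  "'n::{finite,linorder} rvec set \<Rightarrow> 'n rvec set \<Rightarrow> bool" where
  "regular_boundary_part D Rt \<longleftrightarrow>
     openin (top_of_set (frontier D)) Rt \<and>
     hausdorff_measure (CARD('n) - 1) (frontier D - Rt) = 0 \<and>
     (\<forall>x \<in> Rt. \<exists>\<phi> \<phi>' p. local_C1_param (frontier D) x \<phi> \<phi>' p)"

text \<open>
  The tangent space at \<open>x\<close>, the image of the hyperplane under \<open>\<phi>' p\<close>, does not depend on the
  parametrization, so for the domains considered here a single \<open>\<nu>\<close> satisfies this predicate.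
\<close>

definition is_inner_normal ::
  "'n::{finite,linorder} rvec set \<Rightarrow> 'n rvec \<Rightarrow> 'n rvec \<Rightarrow> bool" where
  "is_inner_normal D x \<nu> \<longleftrightarrow>
     norm \<nu> = 1 \<and>
     (\<exists>\<phi> \<phi>' p. local_C1_param (frontier D) x \<phi> \<phi>' p \<and>
        (\<forall>h \<in> base_plane. orthogonal \<nu> (\<phi>' p h))) \<and>
     (\<exists>\<delta>>0. \<forall>t. 0 < t \<and> t < \<delta> \<longrightarrow> x + t *\<^sub>R \<nu> \<in> D)"

definition reflection_density :: "('n::{finite,linorder} rvec \<Rightarrow> real) \<Rightarrow> bool" where
  "reflection_density \<gamma> \<longleftrightarrow>
     \<gamma> \<in> borel_measurable (restrict_space borel (half_sphere e_vec)) \<and>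
     (\<forall>u \<in> half_sphere e_vec. 0 \<le> \<gamma> u) \<and>
     (\<integral>\<^sup>+ u. ennreal (\<gamma> u) \<partial>restrict_space sphere_measure (half_sphere e_vec)) = 1 \<and>
     (\<forall>B. compact B \<and> B \<noteq> {} \<and> B \<subseteq> half_sphere e_vec \<longrightarrow> 0 < (INF u \<in> B. \<gamma> u))"

definition axially_symmetric :: "('n::{finite,linorder} rvec \<Rightarrow> real) \<Rightarrow> bool" where
  "axially_symmetric \<gamma> \<longleftrightarrow>
     (\<forall>u \<in> half_sphere e_vec. \<forall>v \<in> half_sphere e_vec. u \<bullet> e_vec = v \<bullet> e_vec \<longrightarrow> \<gamma> u = \<gamma> v)"

definition reflection_frames ::
  "'n::{finite,linorder} rvec set \<Rightarrow> 'n rvec set \<Rightarrow> ('n rvec \<Rightarrow> 'n sqmat) \<Rightarrow> bool" where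
  "reflection_frames D Rt U \<longleftrightarrow>
     U \<in> borel_measurable (restrict_space borel (frontier D)) \<and>
     (\<forall>x \<in> frontier D. orthogonal_matrix (U x)) \<and>
     (\<forall>x \<in> Rt. is_inner_normal D x (U x *v e_vec))"

definition ae_continuous_frames ::
  "'n::{finite,linorder} rvec set \<Rightarrow> ('n rvec \<Rightarrow> 'n sqmat) \<Rightarrow> bool" where
  "ae_continuous_frames D U \<longleftrightarrow>
     hausdorff_measure (CARD('n) - 1)
       {x \<in> frontier D. \<not> continuous (at x within frontier D) U} = 0"

definition good_points ::
  "'n::{finite,linorder} rvec set \<Rightarrow> 'n rvec set \<Rightarrow> ('n rvec \<Rightarrow> real) \<Rightarrow>
     ('n rvec \<Rightarrow> 'n sqmat) \<Rightarrow> 'n rvec set" where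
  "good_points D Rt \<gamma> U =
     (if axially_symmetric \<gamma> then Rt
      else {x \<in> Rt. continuous (at x within frontier D) U})"

datatype 'a walk_state = At 'a | Escaped | Cemetery

definition flight_time :: "'a::euclidean_space set \<Rightarrow> 'a \<Rightarrow> 'a \<Rightarrow> ereal" where
  "flight_time D x u = Inf (ereal ` {t. 0 < t \<and> x + t *\<^sub>R u \<in> frontier D})"

definition hit :: "'a::euclidean_space set \<Rightarrow> 'a \<Rightarrow> 'a \<Rightarrow> 'a walk_state" where
  "hit D x u =
     (if flight_time D x u < \<infinity> then At (x + real_of_ereal (flight_time D x u) *\<^sub>R u)
      else Escaped)"

text \<open>In what follows \<open>R\<close> is the set of good boundary points and \<open>\<omega>\<close> the sequence of the \<open>\<eta>\<^sub>i\<close>.\<close>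

primrec walk ::
  "'n::finite rvec set \<Rightarrow> 'n rvec set \<Rightarrow> ('n rvec \<Rightarrow> 'n sqmat) \<Rightarrow> 'n rvec \<Rightarrow>
     (nat \<Rightarrow> 'n rvec) \<Rightarrow> nat \<Rightarrow> 'n rvec walk_state" where
  "walk D R U x0 \<omega> 0 = At x0"
| "walk D R U x0 \<omega> (Suc n) =
     (case walk D R U x0 \<omega> n of
        At x \<Rightarrow> if x \<in> R then hit D x (U x *v \<omega> n) else Cemetery
      | Escaped \<Rightarrow> Escaped
      | Cemetery \<Rightarrow> Cemetery)"

text \<open>
  Once the next position is undefined the clock stops. Hence a trajectory entering \<open>Cemetery\<close>
  never has hitting times tending to infinity: the convention does not make such trajectories
  count as favourable ones.
\<close>

definition leg_time ::
  "'n::finite rvec set \<Rightarrow> 'n rvec set \<Rightarrow> ('n rvec \<Rightarrow> 'n sqmat) \<Rightarrow> 'n rvec \<Rightarrow>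
     (nat \<Rightarrow> 'n rvec) \<Rightarrow> nat \<Rightarrow> ereal" where
  "leg_time D R U x0 \<omega> i =
     (case walk D R U x0 \<omega> i of
        At x \<Rightarrow> if x \<in> R then flight_time D x (U x *v \<omega> i) else 0
      | Escaped \<Rightarrow> \<infinity>
      | Cemetery \<Rightarrow> 0)"

definition hitting_time ::
  "'n::finite rvec set \<Rightarrow> 'n rvec set \<Rightarrow> ('n rvec \<Rightarrow> 'n sqmat) \<Rightarrow> 'n rvec \<Rightarrow>
     (nat \<Rightarrow> 'n rvec) \<Rightarrow> nat \<Rightarrow> ereal" where
  "hitting_time D R U x0 \<omega> n = (\<Sum>i<n. leg_time D R U x0 \<omega> i)"

end

theory Submission
  imports Defs
begin

text \<open>
  If the hitting times stay bounded, the reflection points form a Cauchy sequence converging to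
  some boundary point while the flights become arbitrarily short. By the Lipschitz condition, every
  boundary point has a neighbourhood with a cone \<open>K\<close> of directions and an \<open>\<epsilon> > 0\<close> such that every
  flight from that neighbourhood in a direction of \<open>K\<close> lasts at least \<open>\<epsilon>\<close>. Where the boundary
  is smooth, the inner normal \<open>n\<close> satisfies \<open>n \<bullet> u > 0\<close> for \<open>u \<in> K\<close>; on a slightly smaller cone
  this is uniform, so the reflection law charges that cone with a probability bounded away from \<open>0\<close>,
  and almost surely the walk does not stay forever in the neighbourhood making only short flights.
  Countably many such neighbourhoods cover the boundary. The bad boundary points are never hit, since
  the cone over a set of vanishing \<open>(d - 1)\<close>-dimensional Hausdorff measure is a Lebesgue null set.
\<close>

text \<open>The obstacle is uniformity. Near a given boundary point the normals at the good points
  may vary wildly and \<open>U\<close> need not be continuous, so compactness along the boundary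
  gives no common lower bound for the chance of a long flight. The bound comes from the chart alone.
  One ball of directions, whose radius \<rho> depends only on the Lipschitz constant, serves all
  nearby points, and every normal there has inner product at least \<open>\<rho> / 2\<close> with
  each direction in the concentric ball of half the radius. Carried back to the reference half
  sphere by the transpose of \<open>U y\<close>, that smaller ball meets the sphere inside one fixed
  compact cap, where the density has a positive infimum. On the probabilistic side, conditional
  probabilities given the past are avoided: a one-step bound that holds for every fixed state is
  integrated against the law of the past, which is independent of the next direction.\<close>

section \<open>Cones of inward directions in a Lipschitz chart\<close>

lemma base_proj_add: "base_proj (x + y) = base_proj x + base_proj y"
  by (simp add: base_proj_def vec_eq_iff)

lemma base_proj_scaleR: "base_proj (c *\<^sub>R x) = c *\<^sub>R base_proj x"
  by (simp add: base_proj_def vec_eq_iff)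

lemma base_proj_in_base_plane: "base_proj x \<in> base_plane"
  by (simp add: base_proj_def base_plane_def last_coord_def)

lemma norm_base_proj_le: "norm (base_proj x) \<le> norm x"
  unfolding base_proj_def by (rule norm_le_componentwise_cart) simp

text \<open>In the chart \<open>D\<close> lies above a graph of slope at most \<open>L\<close>, so a
  step that rises more than \<open>L\<close> times its horizontal length stays above the graph. The
  directions close to the chart's vertical have this property. Base points in the closure are
  included because the flights start on the boundary.\<close>

lemma lipschitz_boundary_uniform_cone:
  fixes D :: "'n::{finite,linorder} rvec set"
  assumes "lipschitz_boundary D" "open D" "x \<in> frontier D"
  obtains v \<rho> \<epsilon> where "norm v = 1" "0 < \<rho>" "\<rho> \<le> 1" "0 < \<epsilon>"
    "\<And>y u t. \<lbrakk>y \<in> closure D; dist x y < \<epsilon>; dist v u < \<rho>; 0 < t; t < \<epsilon>\<rbrakk> \<Longrightarrow> y + t *\<^sub>R u \<in> D"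
proof -
  from assms obtain \<epsilon> J f L where e: "0 < \<epsilon>" and J: "affine_isometry J" "J x = 0"
    and L: "L-lipschitz_on base_plane f"
    and im: "J ` (D \<inter> ball x \<epsilon>) = {z \<in> ball 0 \<epsilon>. last_coord z > f (base_proj z)}"
    unfolding lipschitz_boundary_def by meson
  from J obtain T c where T: "orthogonal_transformation T" and Jc: "J = (\<lambda>y. T y + c)"
    unfolding affine_isometry_def by auto
  have linT: "linear T" using T by (rule orthogonal_transformation_linear)
  have injT: "inj T" using T by (rule orthogonal_transformation_inj)
  have nT: "norm (T u) = norm u" for u using T by (simp add: orthogonal_transformation)
  have Jd: "J (y + u) = J y + T u" for y u by (simp add: Jc linear_add[OF linT])
  have L0: "0 \<le> L" using L by (rule lipschitz_on_nonneg)
  define d :: "'n rvec" where "d = axis (Max UNIV) 1"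
  have "surj T" using T by (rule orthogonal_transformation_surj)
  then obtain v where v: "T v = d" by (metis surjD)
  have nv: "norm v = 1" using nT[of v] by (simp add: v d_def)
  \<comment> \<open>Directions within \<rho> of the vertical have horizontal part below \<rho> and
    vertical part above \<open>1 - \<rho>\<close>; this choice solves
    \<open>L * \<rho> = 1 - \<rho>\<close>.\<close>
  define \<rho> where "\<rho> = 1 / (1 + L)"
  have rho: "0 < \<rho>" "\<rho> \<le> 1" "L * \<rho> = 1 - \<rho>" using L0 by (auto simp: \<rho>_def field_simps)
  \<comment> \<open>The base point is within \<open>\<epsilon> / 3\<close> of \<open>x\<close> and
    the step is shorter than \<open>2 * \<epsilon> / 3\<close>, since \<open>norm u < 2\<close>; so
    the end stays in the ball of the chart.\<close>
  have stepD: "y + t *\<^sub>R u \<in> D"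
    if y: "y \<in> D" "dist x y < \<epsilon> / 3" and u: "dist v u < \<rho>" and t: "0 < t" "t < \<epsilon> / 3" for y u t
  proof -
    have nu: "norm u < 2" using u nv rho norm_triangle_ineq[of v "u - v"] by (simp add: dist_norm norm_minus_commute)
    have "J y \<in> J ` (D \<inter> ball x \<epsilon>)" using y e by auto
    then have fy: "f (base_proj (J y)) < last_coord (J y)" unfolding im by auto
    define h where "h = T u"
    define k where "k = h - d"
    have nk: "norm k < \<rho>" using u nT[of "u - v"] by (simp add: k_def h_def v linear_diff[OF linT] dist_norm norm_minus_commute)
    have "base_proj h = base_proj k" by (auto simp: k_def base_proj_def d_def vec_eq_iff axis_def)
    then have bh: "norm (base_proj h) < \<rho>" using nk norm_base_proj_le[of k] by simp
    have "last_coord h = 1 + last_coord k" by (simp add: k_def last_coord_def d_def)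
    moreover have "\<bar>last_coord k\<bar> < \<rho>" using nk component_le_norm_cart[of k "Max UNIV"] by (simp add: last_coord_def)
    ultimately have lh: "last_coord h > 1 - \<rho>" by linarith
    define z where "z = J (y + t *\<^sub>R u)"
    have z: "z = J y + t *\<^sub>R h" by (simp add: z_def Jd h_def linear_cmul[OF linT])
    have "dist (f (base_proj z)) (f (base_proj (J y))) \<le> L * dist (base_proj z) (base_proj (J y))"
      by (rule lipschitz_onD[OF L]) (auto simp: base_proj_in_base_plane)
    also have "\<dots> = t * (L * norm (base_proj h))" using t
      by (simp add: z base_proj_add base_proj_scaleR dist_norm)
    also have "\<dots> \<le> t * (L * \<rho>)" using t bh L0 by (intro mult_left_mono) auto
    also have "\<dots> < t * last_coord h" using t lh rho by simp
    finally have "f (base_proj z) < f (base_proj (J y)) + t * last_coord h" by (simp add: dist_norm)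
    also have "\<dots> < last_coord z" using fy by (simp add: z last_coord_def)
    finally have fz: "f (base_proj z) < last_coord z" .
    have "norm (T (y + t *\<^sub>R u - x)) < \<epsilon>"
    proof -
      have "norm (y + t *\<^sub>R u - x) \<le> norm (y - x) + t * norm u"
        using norm_triangle_ineq[of "y - x" "t *\<^sub>R u"] t by (simp add: algebra_simps)
      also have "t * norm u \<le> t * 2" using nu t by simp
      finally show ?thesis using y t by (simp add: nT dist_norm norm_minus_commute)
    qed
    moreover have "T (y + t *\<^sub>R u - x) = z" using Jd[of x "y + t *\<^sub>R u - x"] J(2) by (simp add: z_def)
    ultimately have "z \<in> J ` (D \<inter> ball x \<epsilon>)" unfolding im using fz by simp
    then obtain w where "w \<in> D" "J w = J (y + t *\<^sub>R u)" unfolding z_def by auto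
    moreover from this have "w = y + t *\<^sub>R u" using injT by (simp add: Jc inj_eq)
    ultimately show ?thesis by simp
  qed
  show thesis
  proof (rule that[of v \<rho> "\<epsilon> / 3"])
    fix y u t
    assume y: "y \<in> closure D" "dist x y < \<epsilon> / 3" and u: "dist v u < \<rho>" and t: "0 < t" "t < \<epsilon> / 3"
    \<comment> \<open>A point \<open>y'\<close> of \<open>D\<close> this close to \<open>y\<close>
      is still within \<open>\<epsilon> / 3\<close> of \<open>x\<close>, and the direction
      \<open>u'\<close> that leads from \<open>y'\<close> to the same end point in time
      \<open>t\<close> is still within \<rho> of \<open>v\<close>.\<close>
    define r where "r = min (\<epsilon> / 3 - dist x y) (t * (\<rho> - dist v u))"
    have "0 < r" using y u t by (simp add: r_def)
    then obtain y' where y': "y' \<in> D" "dist y' y < r" using y(1) closure_approachable by blast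
    define u' where "u' = u + (1 / t) *\<^sub>R (y - y')"
    have "dist x y' < \<epsilon> / 3" using y'(2) dist_triangle[of x y' y] by (simp add: r_def dist_commute)
    moreover have "dist v u' < \<rho>"
    proof -
      have "dist u u' = dist y' y / t" using t by (simp add: u'_def dist_norm norm_minus_commute)
      also have "\<dots> < \<rho> - dist v u" using y'(2) t by (simp add: r_def field_simps)
      finally show ?thesis using dist_triangle[of v u' u] by linarith
    qed
    ultimately have "y' + t *\<^sub>R u' \<in> D" using stepD y' t by blast
    then show "y + t *\<^sub>R u \<in> D" using t by (simp add: u'_def algebra_simps)
  qed (use nv rho e in auto)
qed

section \<open>Tangent vectors and inner normals\<close>

lemma base_plane_eq_hyperplane:
  "base_plane = {z :: 'n::{finite,linorder} rvec. axis (Max UNIV) 1 \<bullet> z = 0}"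
  by (simp add: base_plane_def last_coord_def inner_axis' )

text \<open>Dimension count: by injectivity the image of the hyperplane has dimension
  \<open>CARD('n) - 1\<close>, and it is contained in the orthogonal complement of \<open>n\<close>,
  which has the same dimension.\<close>

lemma C1_param_tangent_surj:
  fixes S :: "'n::{finite,linorder} rvec set"
  assumes par: "local_C1_param S x \<phi> \<phi>' p" and n: "n \<noteq> 0" "\<forall>h \<in> base_plane. orthogonal n (\<phi>' p h)"
    and w: "orthogonal n w"
  shows "\<exists>h \<in> base_plane. \<phi>' p h = w"
proof -
  from par obtain V where V: "p \<in> V"
    "\<forall>q \<in> V. (\<phi> has_derivative \<phi>' q) (at q within V) \<and> inj_on (\<phi>' q) base_plane"
    unfolding local_C1_param_def by blast
  then have lin: "linear (\<phi>' p)" and inj: "inj_on (\<phi>' p) base_plane"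
    by (auto dest: has_derivative_linear)
  have sub: "subspace (base_plane :: 'n rvec set)"
    unfolding base_plane_eq_hyperplane by (rule subspace_hyperplane)
  have "dim (\<phi>' p ` base_plane) = dim (base_plane :: 'n rvec set)"
    using inj by (intro dim_image_eq[OF lin]) (simp add: span_eq_iff[THEN iffD2, OF sub])
  also have "\<dots> = CARD('n) - 1"
    unfolding base_plane_eq_hyperplane by (subst dim_hyperplane) auto
  also have "\<dots> = dim {z. n \<bullet> z = 0}" using n(1) by (simp add: dim_hyperplane)
  finally have "\<phi>' p ` base_plane = {z. n \<bullet> z = 0}"
    using n(2) linear_subspace_image[OF lin sub]
    by (intro subspace_dim_equal) (auto simp: subspace_hyperplane orthogonal_def)
  then show ?thesis using w unfolding orthogonal_def by (metis (mono_tags) imageE mem_Collect_eq)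
qed

text \<open>The curve is the image under \<phi> of the line \<open>p + t *\<^sub>R h\<close>, where
  \<open>h\<close> is a preimage of \<open>w\<close>. For small \<open>t\<close> the line stays in
  the parameter domain, which is open in the hyperplane containing \<open>h\<close>.\<close>

lemma C1_param_curve:
  fixes S :: "'n::{finite,linorder} rvec set"
  assumes par: "local_C1_param S x \<phi> \<phi>' p" and n: "n \<noteq> 0" "\<forall>h \<in> base_plane. orthogonal n (\<phi>' p h)"
    and w: "orthogonal n w"
  obtains q where "\<forall>\<^sub>F t in at_right 0. q t \<in> S" "((\<lambda>t::real. (q t - x) /\<^sub>R t) \<longlongrightarrow> w) (at_right 0)"
proof -
  from C1_param_tangent_surj[OF assms] obtain h where h: "h \<in> base_plane" "\<phi>' p h = w" by blast
  from par obtain V W \<psi> where V: "openin (top_of_set base_plane) V" "p \<in> V" "\<phi> p = x"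
    and hom: "homeomorphism V (S \<inter> W) \<phi> \<psi>"
    and der: "(\<phi> has_derivative \<phi>' p) (at p within V)"
    unfolding local_C1_param_def by blast
  from V(1) obtain O' where O': "open O'" "V = base_plane \<inter> O'" by (auto simp: openin_open)
  have "((\<lambda>t. p + t *\<^sub>R h) \<longlongrightarrow> p + 0 *\<^sub>R h) (at_right 0)" by (intro tendsto_intros)
  then have ev: "\<forall>\<^sub>F t in at_right 0. p + t *\<^sub>R h \<in> V"
    using topological_tendstoD[of "\<lambda>t. p + t *\<^sub>R h" _ "at_right 0" O'] O' V(2) h(1)
    by (auto simp: base_plane_def last_coord_def elim!: eventually_mono)
  then obtain r where r: "0 < r" "\<And>t. 0 < t \<Longrightarrow> t < r \<Longrightarrow> p + t *\<^sub>R h \<in> V"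
    unfolding eventually_at_right_field by auto
  show thesis
  proof (rule that[of "\<lambda>t. \<phi> (p + t *\<^sub>R h)"])
    show "\<forall>\<^sub>F t in at_right 0. \<phi> (p + t *\<^sub>R h) \<in> S"
      using ev by eventually_elim (use hom in \<open>auto simp: homeomorphism_def\<close>)
    have "((\<lambda>t. p + t *\<^sub>R h) has_derivative (\<lambda>t. t *\<^sub>R h)) (at 0 within {0<..<r})"
      by (auto intro!: derivative_eq_intros)
    moreover have "(\<lambda>t. p + t *\<^sub>R h) ` {0<..<r} \<subseteq> V" using r by auto
    ultimately have "(\<phi> \<circ> (\<lambda>t. p + t *\<^sub>R h) has_derivative \<phi>' p \<circ> (\<lambda>t. t *\<^sub>R h)) (at 0 within {0<..<r})"
      using der by (intro diff_chain_within) (auto intro: has_derivative_subset)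
    moreover have "\<phi>' p (t *\<^sub>R h) = t *\<^sub>R w" for t
      using has_derivative_linear[OF der] h(2) by (simp add: linear_cmul)
    moreover have "at 0 within {0<..<r} = at_right 0"
      using r(1) by (intro at_within_nhd[of _ "{-r<..<r}"]) auto
    ultimately have "((\<lambda>t. (\<phi> (p + t *\<^sub>R h) - x - t *\<^sub>R w) /\<^sub>R \<bar>t\<bar>) \<longlongrightarrow> 0) (at_right 0)"
      using V(3) r(1) by (simp add: has_derivative_at_within o_def)
    then have "((\<lambda>t. (\<phi> (p + t *\<^sub>R h) - x) /\<^sub>R t - w) \<longlongrightarrow> 0) (at_right 0)"
    proof (rule Lim_transform_eventually)
      show "\<forall>\<^sub>F t in at_right 0. (\<phi> (p + t *\<^sub>R h) - x - t *\<^sub>R w) /\<^sub>R \<bar>t\<bar> = (\<phi> (p + t *\<^sub>R h) - x) /\<^sub>R t - w"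
        using eventually_at_right_less[of "0::real"] by eventually_elim (simp add: algebra_simps)
    qed
    then show "((\<lambda>t. (\<phi> (p + t *\<^sub>R h) - x) /\<^sub>R t) \<longlongrightarrow> w) (at_right 0)"
      by (simp add: LIM_zero_iff)
  qed
qed

text \<open>If \<open>n \<bullet> u\<close> were not positive, some tangent vector would be a
  positive multiple of \<open>u\<close> plus a nonnegative multiple of \<open>n\<close>. A boundary
  curve with that velocity would be pushed into \<open>D\<close> by the cone, but the open set
  \<open>D\<close> contains no boundary point.\<close>

lemma inner_normal_cone_pos:
  fixes D :: "'n::{finite,linorder} rvec set"
  assumes "open D" and n: "is_inner_normal D y n"
    and "open K" "0 < \<epsilon>"
    and cone: "\<And>y' u t. \<lbrakk>y' \<in> closure D; dist y y' < \<epsilon>; u \<in> K; 0 < t; t < \<epsilon>\<rbrakk> \<Longrightarrow> y' + t *\<^sub>R u \<in> D"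
    and u: "u \<in> K"
  shows "0 < n \<bullet> u"
proof (rule ccontr)
  assume neg: "\<not> 0 < n \<bullet> u"
  from n obtain \<phi> \<phi>' p \<delta> where nn: "norm n = 1" and par: "local_C1_param (frontier D) y \<phi> \<phi>' p"
    and ort: "\<forall>h \<in> base_plane. orthogonal n (\<phi>' p h)"
    and inn: "0 < \<delta>" "\<And>t. 0 < t \<Longrightarrow> t < \<delta> \<Longrightarrow> y + t *\<^sub>R n \<in> D"
    unfolding is_inner_normal_def by blast
  have n0: "n \<noteq> 0" using nn by auto
  have yF: "y \<in> frontier D" using par unfolding local_C1_param_def homeomorphism_def by blast
  have disj: "frontier D \<inter> D = {}" using \<open>open D\<close> by (simp add: frontier_def interior_open) blast
  \<comment> \<open>A boundary curve with velocity \<open>m + c u\<close> is at time \<open>t\<close> at \<open>(y + t m) + t c u + o(t)\<close>, hence in \<open>D\<close>.\<close>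
  have *: False if c: "0 < c" and m: "orthogonal n (m + c *\<^sub>R u)"
    and mD: "\<forall>\<^sub>F t in at_right 0. y + t *\<^sub>R m \<in> closure D" for c m
  proof -
    obtain q where q: "\<forall>\<^sub>F t in at_right 0. q t \<in> frontier D"
      "((\<lambda>t. (q t - y) /\<^sub>R t) \<longlongrightarrow> m + c *\<^sub>R u) (at_right 0)"
      using C1_param_curve[OF par n0 ort m] by blast
    have "((\<lambda>t. ((q t - y) /\<^sub>R t - m) /\<^sub>R c) \<longlongrightarrow> (m + c *\<^sub>R u - m) /\<^sub>R c) (at_right 0)"
      by (intro tendsto_intros q)
    then have lim: "((\<lambda>t. ((q t - y) /\<^sub>R t - m) /\<^sub>R c) \<longlongrightarrow> u) (at_right 0)" using c by simp
    then have e1: "\<forall>\<^sub>F t in at_right 0. ((q t - y) /\<^sub>R t - m) /\<^sub>R c \<in> K"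
      using \<open>open K\<close> u by (rule topological_tendstoD)
    have "((\<lambda>t. t * c) \<longlongrightarrow> 0 * c) (at_right 0)" by (intro tendsto_intros)
    then have e2: "\<forall>\<^sub>F t in at_right 0. t * c < \<epsilon>"
      using \<open>0 < \<epsilon>\<close> by (auto dest!: order_tendstoD(2))
    have "((\<lambda>t. norm (t *\<^sub>R m)) \<longlongrightarrow> norm (0 *\<^sub>R m)) (at_right 0)" by (intro tendsto_intros)
    then have e3: "\<forall>\<^sub>F t in at_right 0. norm (t *\<^sub>R m) < \<epsilon>"
      using \<open>0 < \<epsilon>\<close> by (intro order_tendstoD(2)) auto
    have e4: "\<forall>\<^sub>F t in at_right (0::real). 0 < t" by (simp add: eventually_at_right_less)
    have "\<forall>\<^sub>F t in at_right (0::real). False"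
      using e1 e2 e3 e4 q(1) mD
    proof eventually_elim
      case (elim t)
      have "(y + t *\<^sub>R m) + (t * c) *\<^sub>R (((q t - y) /\<^sub>R t - m) /\<^sub>R c) \<in> D"
        using elim c by (intro cone) (auto simp: dist_norm)
      moreover have "(y + t *\<^sub>R m) + (t * c) *\<^sub>R (((q t - y) /\<^sub>R t - m) /\<^sub>R c) = q t"
        using elim c by (simp add: algebra_simps)
      ultimately show False using elim disj by auto
    qed
    then show False by simp
  qed
  show False
  proof (cases "n \<bullet> u = 0")
    case True
    \<comment> \<open>Here \<open>u\<close> is itself tangent, so the base point \<open>y\<close>
      need not be moved.\<close>
    show False using True yF by (intro *[of 1 0]) (auto simp: orthogonal_def frontier_def)
  next
    case False
    then have "n \<bullet> u < 0" using neg by simp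
    moreover have "\<forall>\<^sub>F t in at_right 0. y + t *\<^sub>R n \<in> closure D"
      using inn closure_subset[of D] unfolding eventually_at_right_field by blast
    moreover have "n \<bullet> n = 1" using nn by (simp add: norm_eq_1)
    \<comment> \<open>The coefficient cancels the normal component of
      \<open>n + c *\<^sub>R u\<close>. It is positive because \<open>n \<bullet> u\<close> is
      negative, and the moved base points lie in \<open>D\<close> because \<open>n\<close> points
      inwards.\<close>
    ultimately show False by (intro *[of "- 1 / (n \<bullet> u)" n]) (auto simp: orthogonal_def inner_diff_right divide_neg_neg)
  qed
qed

section \<open>Cones over Hausdorff null sets\<close>

text \<open>A covering set of size \<open>r\<close> spans with \<open>x\<close> a thin tube, which
  about \<open>m / r\<close> balls of radius proportional to \<open>r\<close> cover. Their total
  volume is of order \<open>r ^ (DIM('a) - 1)\<close>, the very quantity that the Hausdorff content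
  sums.\<close>

lemma hausdorff_null_negligible_bounded_cone:
  fixes N :: "'a::euclidean_space set"
  assumes N: "hausdorff_measure (DIM('a) - 1) N = 0" and d: "2 \<le> DIM('a)"
    and m: "1 \<le> m" "N \<subseteq> cball x m"
  shows "negligible {s *\<^sub>R (y - x) | s y. 0 \<le> s \<and> s \<le> m \<and> y \<in> N}"
proof -
  define k where "k = DIM('a) - 1"
  have k: "0 < k" "DIM('a) = Suc k" using d by (auto simp: k_def)
  define \<beta> where "\<beta> = unit_ball_vol (real k) / 2 ^ k"
  have beta: "0 < \<beta>" by (simp add: \<beta>_def unit_ball_vol_pos)
  define K where "K = unit_ball_vol (real DIM('a)) * (2 * m) ^ Suc k * (m + 2)"
  have K: "0 < K" using m by (simp add: K_def)
  show ?thesis unfolding negligible_outer_le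
  proof (intro allI impI)
    fix e :: real assume e: "0 < e"
    \<comment> \<open>One half of \<open>e\<close> pays for the powers of the diameters, the other
      for enlarging the diameters to the radii \<open>r i\<close>.\<close>
    define e' where "e' = e / (2 * K)"
    have e': "0 < e'" using e K by (simp add: e'_def)
    \<comment> \<open>Diameters of at most \<open>1/2\<close> leave room for radii
      \<open>r i\<close> that exceed them and are at most \<open>1\<close>.\<close>
    have "hausdorff_content k (1/2) N \<le> hausdorff_measure k N"
      unfolding hausdorff_measure_def by (rule SUP_upper) auto
    then have "hausdorff_content k (1/2) N < ennreal (\<beta> * e')"
      using N beta e' by (simp add: k_def)
    then obtain C :: "nat \<Rightarrow> 'a set" where C: "N \<subseteq> (\<Union>i. C i)" "\<And>i. bounded (C i)" "\<And>i. diameter (C i) \<le> 1/2"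
      and sumC: "(\<Sum>i. ennreal (unit_ball_vol (real k) * (diameter (C i) / 2) ^ k)) < ennreal (\<beta> * e')"
      unfolding hausdorff_content_def INF_less_iff by auto
    have dC: "0 \<le> diameter (C i)" for i using C(2) by (rule diameter_ge_0)
    \<comment> \<open>The radius must be strictly larger than the diameter, since a covering set may
      be a single point and the number of balls involves \<open>m / r i\<close>. The excesses of the
      powers are summable with total \<open>e'\<close>.\<close>
    have "\<exists>r. diameter (C i) < r \<and> r \<le> 1 \<and> r ^ k < diameter (C i) ^ k + e' * (1/2) ^ Suc i" for i
    proof -
      have "((\<lambda>r. r ^ k) \<longlongrightarrow> diameter (C i) ^ k) (at_right (diameter (C i)))" by (intro tendsto_intros)
      then have "\<forall>\<^sub>F r in at_right (diameter (C i)). r ^ k < diameter (C i) ^ k + e' * (1/2) ^ Suc i"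
        using e' by (intro order_tendstoD(2)) auto
      moreover have "\<forall>\<^sub>F r in at_right (diameter (C i)). r \<in> {diameter (C i)<..<1}"
        using C(3)[of i] by (intro eventually_at_right_real) auto
      ultimately have "\<forall>\<^sub>F r in at_right (diameter (C i)). diameter (C i) < r \<and> r \<le> 1 \<and> r ^ k < diameter (C i) ^ k + e' * (1/2) ^ Suc i"
        by eventually_elim auto
      then show ?thesis by (rule eventually_happens'[rotated]) simp
    qed
    then obtain r where r: "\<And>i. diameter (C i) < r i" "\<And>i. r i \<le> 1"
      "\<And>i. r i ^ k < diameter (C i) ^ k + e' * (1/2) ^ Suc i" by metis
    have r0: "0 < r i" for i using r(1)[of i] dC[of i] by linarith
    define c where "c i = (SOME y. y \<in> C i \<inter> N)" for i
    define J where "J i = nat \<lceil>m / r i\<rceil>" for i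
    \<comment> \<open>The centres are spaced \<open>r i\<close> in the parameter along the direction
      to \<open>c i\<close>. Rounding the parameter costs at most \<open>m * r i\<close> and
      replacing \<open>y\<close> by \<open>c i\<close> less than \<open>m * r i\<close>, hence the
      radius \<open>2 * m * r i\<close>.\<close>
    define T where "T i = (\<Union>j\<in>{..J i}. ball ((real j * r i) *\<^sub>R (c i - x)) (2 * m * r i))" for i
    have T_sub: "s *\<^sub>R (y - x) \<in> T i" if "0 \<le> s" "s \<le> m" "y \<in> N" "y \<in> C i" for s y i
    proof -
      have "c i \<in> C i \<inter> N" unfolding c_def by (rule someI[of _ y]) (use that in auto)
      then have ci: "dist y (c i) < r i" "norm (c i - x) \<le> m"
        using diameter_bounded_bound[OF C(2), of y i "c i"] r(1)[of i] that m by (auto simp: dist_norm norm_minus_commute)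
      define j where "j = nat \<lfloor>s / r i\<rfloor>"
      have j: "real j \<le> s / r i" "s / r i < real j + 1" using that r0[of i] unfolding j_def by auto
      have "real j \<le> m / r i" using j(1) that r0[of i] by (meson divide_right_mono less_imp_le order_trans)
      then have "j \<le> J i" unfolding J_def by linarith
      have a: "\<bar>real j * r i - s\<bar> < r i" using j r0[of i] by (simp add: field_simps abs_if)
      have "(real j * r i) *\<^sub>R (c i - x) - s *\<^sub>R (y - x) = (real j * r i - s) *\<^sub>R (c i - x) + s *\<^sub>R (c i - y)"
        by (simp add: algebra_simps)
      then have "norm ((real j * r i) *\<^sub>R (c i - x) - s *\<^sub>R (y - x)) \<le> \<bar>real j * r i - s\<bar> * norm (c i - x) + s * norm (c i - y)"
        using that norm_triangle_ineq[of "(real j * r i - s) *\<^sub>R (c i - x)" "s *\<^sub>R (c i - y)"] by simp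
      also have "s * norm (c i - y) \<le> m * norm (c i - y)" using that by (intro mult_right_mono) auto
      also have "m * norm (c i - y) < m * r i" using ci m by (simp add: dist_norm norm_minus_commute)
      also have "\<bar>real j * r i - s\<bar> * norm (c i - x) \<le> r i * m" using a ci r0[of i] by (intro mult_mono) auto
      finally have "dist ((real j * r i) *\<^sub>R (c i - x)) (s *\<^sub>R (y - x)) < 2 * m * r i" by (simp add: dist_norm algebra_simps)
      then show ?thesis using \<open>j \<le> J i\<close> unfolding T_def by auto
    qed
    have Tm: "T i \<in> sets lborel" for i unfolding T_def by simp
    have T_le: "emeasure lborel (T i) \<le> ennreal (K * r i ^ k)" for i
    proof -
      have "emeasure lborel (T i) \<le> (\<Sum>j\<in>{..J i}. emeasure lborel (ball ((real j * r i) *\<^sub>R (c i - x)) (2 * m * r i)))"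
        unfolding T_def by (rule emeasure_subadditive_finite) auto
      also have "\<dots> = (\<Sum>j\<in>{..J i}. ennreal (unit_ball_vol (real DIM('a)) * (2 * m * r i) ^ Suc k))"
        using m r0[of i] by (intro sum.cong refl) (subst emeasure_ball, auto simp: k(2))
      also have "\<dots> = ennreal (real (J i + 1) * (unit_ball_vol (real DIM('a)) * (2 * m * r i) ^ Suc k))"
        using m r0[of i] by (subst sum_ennreal) auto
      also have "\<dots> \<le> ennreal (K * r i ^ k)"
      proof (rule ennreal_leI)
        have "0 \<le> m / r i" using m r0[of i] by simp
        then have "real (J i) \<le> m / r i + 1" unfolding J_def by linarith
        then have "real (J i + 1) * r i \<le> (m / r i + 2) * r i" using r0[of i] by (intro mult_right_mono) auto
        also have "\<dots> \<le> m + 2" using r0[of i] r(2)[of i] by (simp add: field_simps)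
        finally have J: "real (J i + 1) * r i \<le> m + 2" .
        have "real (J i + 1) * (unit_ball_vol (real DIM('a)) * (2 * m * r i) ^ Suc k)
           = unit_ball_vol (real DIM('a)) * (2 * m) ^ Suc k * r i ^ k * (real (J i + 1) * r i)"
          by (simp add: power_mult_distrib mult_ac)
        also have "\<dots> \<le> unit_ball_vol (real DIM('a)) * (2 * m) ^ Suc k * r i ^ k * (m + 2)"
          using J m r0[of i] by (intro mult_left_mono) auto
        finally show "real (J i + 1) * (unit_ball_vol (real DIM('a)) * (2 * m * r i) ^ Suc k) \<le> K * r i ^ k"
          by (simp add: K_def mult_ac)
      qed
      finally show ?thesis .
    qed
    have "(\<Sum>i. ennreal (\<beta> * diameter (C i) ^ k)) < ennreal (\<beta> * e')"
      using sumC by (simp add: \<beta>_def power_divide)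
    then have s1: "ennreal \<beta> * (\<Sum>i. ennreal (diameter (C i) ^ k)) < ennreal \<beta> * ennreal e'"
      using beta e' dC by (simp add: ennreal_mult)
    have s2: "(\<Sum>i. ennreal (diameter (C i) ^ k)) \<le> ennreal e'"
    proof (rule ccontr)
      assume "\<not> ?thesis"
      then have "ennreal \<beta> * ennreal e' \<le> ennreal \<beta> * (\<Sum>i. ennreal (diameter (C i) ^ k))"
        by (intro mult_left_mono) auto
      then show False using s1 by simp
    qed
    have "emeasure lborel (\<Union>i. T i) \<le> (\<Sum>i. emeasure lborel (T i))"
      using Tm by (intro emeasure_subadditive_countably) auto
    also have "\<dots> \<le> (\<Sum>i. ennreal K * (ennreal (diameter (C i) ^ k) + ennreal (e' * (1/2) ^ Suc i)))"
    proof (intro suminf_le)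
      fix i
      have "emeasure lborel (T i) \<le> ennreal (K * (diameter (C i) ^ k + e' * (1/2) ^ Suc i))"
        using T_le[of i] r(3)[of i] K by (elim order_trans) (intro ennreal_leI mult_left_mono, auto)
      then show "emeasure lborel (T i) \<le> ennreal K * (ennreal (diameter (C i) ^ k) + ennreal (e' * (1/2) ^ Suc i))"
        using K e' dC[of i] by (simp add: ennreal_mult ennreal_plus[symmetric] del: ennreal_plus)
    qed auto
    also have "\<dots> = ennreal K * ((\<Sum>i. ennreal (diameter (C i) ^ k)) + (\<Sum>i. ennreal (e' * (1/2) ^ Suc i)))"
      by (simp add: suminf_add)
    also have "(\<Sum>i. ennreal (e' * (1/2) ^ Suc i)) = ennreal e'"
    proof -
      have "(\<lambda>i. e' * (1/2) ^ Suc i) sums (e' * 1)" by (intro sums_mult power_half_series)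
      then show ?thesis using e' by (intro suminf_ennreal_eq) auto
    qed
    also have "ennreal K * ((\<Sum>i. ennreal (diameter (C i) ^ k)) + ennreal e') \<le> ennreal K * (ennreal e' + ennreal e')"
      using s2 by (intro mult_left_mono add_right_mono) auto
    also have "\<dots> = ennreal e" using K e' by (simp add: ennreal_plus[symmetric] ennreal_mult[symmetric] e'_def del: ennreal_plus)
    finally have le: "emeasure lborel (\<Union>i. T i) \<le> ennreal e" .
    let ?T = "\<Union>i. T i"
    have Tb: "?T \<in> sets borel" using Tm by auto
    have "?T \<in> lmeasurable" unfolding fmeasurable_def
      using le Tb by (auto simp: emeasure_completion less_top[symmetric] top_unique)
    moreover have "measure lebesgue ?T \<le> e"
      using le Tb e by (simp add: measure_def emeasure_completion enn2real_leI)
    moreover have "{s *\<^sub>R (y - x) | s y. 0 \<le> s \<and> s \<le> m \<and> y \<in> N} \<subseteq> ?T" using C(1) T_sub by blast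
    ultimately show "\<exists>T. {s *\<^sub>R (y - x) | s y. 0 \<le> s \<and> s \<le> m \<and> y \<in> N} \<subseteq> T \<and> T \<in> lmeasurable \<and> measure lebesgue T \<le> e"
      by blast
  qed
qed


lemma hausdorff_measure_mono: "A \<subseteq> B \<Longrightarrow> hausdorff_measure k A \<le> hausdorff_measure k B"
  unfolding hausdorff_measure_def hausdorff_content_def
  by (intro SUP_mono') (rule INF_superset_mono, auto)

text \<open>Exhaustion by bounded cones; \<open>Suc m\<close> instead of \<open>m\<close> keeps the
  bound at least \<open>1\<close>.\<close>

lemma hausdorff_null_negligible_cone:
  fixes N :: "'a::euclidean_space set"
  assumes N: "hausdorff_measure (DIM('a) - 1) N = 0" and d: "2 \<le> DIM('a)"
  shows "negligible {s *\<^sub>R (y - x) | s y. 0 \<le> s \<and> y \<in> N}"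
proof (rule negligible_subset)
  have "negligible {s *\<^sub>R (y - x) | s y. 0 \<le> s \<and> s \<le> real (Suc m) \<and> y \<in> N \<inter> cball x (real (Suc m))}" for m
  proof (rule hausdorff_null_negligible_bounded_cone)
    show "hausdorff_measure (DIM('a) - 1) (N \<inter> cball x (real (Suc m))) = 0"
      using hausdorff_measure_mono[of "N \<inter> cball x (real (Suc m))" N "DIM('a) - 1"] N by simp
  qed (use d in auto)
  then show "negligible (\<Union>m. {s *\<^sub>R (y - x) | s y. 0 \<le> s \<and> s \<le> real (Suc m) \<and> y \<in> N \<inter> cball x (real (Suc m))})"
    by (rule negligible_Union_nat)
  show "{s *\<^sub>R (y - x) | s y. 0 \<le> s \<and> y \<in> N} \<subseteq>
    (\<Union>m. {s *\<^sub>R (y - x) | s y. 0 \<le> s \<and> s \<le> real (Suc m) \<and> y \<in> N \<inter> cball x (real (Suc m))})"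
  proof safe
    fix s :: real and y assume s: "0 \<le> s" "y \<in> N"
    obtain m where "max s (dist x y) \<le> real m" using real_arch_simple by blast
    then have "s \<le> real (Suc m)" "y \<in> cball x (real (Suc m))" by auto
    then show "s *\<^sub>R (y - x) \<in> (\<Union>m. {s *\<^sub>R (y - x) | s y. 0 \<le> s \<and> s \<le> real (Suc m) \<and> y \<in> N \<inter> cball x (real (Suc m))})"
      using s by blast
  qed
qed

section \<open>Surface measure and the law of a reflected direction\<close>

lemma sets_sphere_measure [simp]: "sets sphere_measure = sets borel"
  by (simp add: sphere_measure_def)

lemma space_sphere_measure [simp]: "space sphere_measure = UNIV"
  by (simp add: sphere_measure_def space_scale_measure)

lemma emeasure_sphere_measure:
  fixes A :: "'a::euclidean_space set"
  assumes A: "A \<in> sets borel"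
  shows "emeasure sphere_measure A = of_nat DIM('a) * emeasure lborel {z \<in> ball 0 1. sgn z \<in> A}"
proof -
  have m: "sgn \<in> measurable (restrict_space lborel (ball 0 1)) (borel :: 'a measure)"
    by (intro measurable_restrict_space1) simp
  have "sgn -` A \<inter> ball 0 1 = {z \<in> ball 0 1. sgn z \<in> A}" by auto
  then show ?thesis
    using A by (simp add: sphere_measure_def emeasure_distr[OF m] space_restrict_space) (subst emeasure_restrict_space, auto)
qed

lemma half_sphere_borel [measurable, simp]: "half_sphere v \<in> sets borel"
proof -
  have "half_sphere v = sphere 0 1 \<inter> {w. v \<bullet> w > 0}" by (auto simp: half_sphere_def)
  then show ?thesis by (auto intro!: borel_closed borel_open open_halfspace_gt)
qed

lemma norm_orthogonal_matrix_mult: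
  fixes Q :: "real ^ 'n ^ 'n"
  shows "orthogonal_matrix Q \<Longrightarrow> norm (Q *v u) = norm u"
  by (metis orthogonal_transformation orthogonal_transformation_matrix matrix_of_matrix_vector_mul matrix_vector_mul_linear)

lemma inner_orthogonal_matrix_mult:
  fixes Q :: "real ^ 'n ^ 'n"
  shows "orthogonal_matrix Q \<Longrightarrow> (Q *v u) \<bullet> (Q *v w) = u \<bullet> w"
  by (metis orthogonal_transformation_def orthogonal_transformation_matrix matrix_of_matrix_vector_mul matrix_vector_mul_linear)

lemma measurable_half_sphere_density:
  assumes "distributed M (restrict_space sphere_measure (half_sphere v)) X f"
  shows "X \<in> borel_measurable M" and "\<omega> \<in> space M \<Longrightarrow> X \<omega> \<in> half_sphere v"
  using distributed_measurable[OF assms] by (auto simp: measurable_restrict_space2_iff space_restrict_space cong: measurable_cong_sets)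

text \<open>If \<open>sgn z\<close> lies in \<open>A\<close>, then \<open>Q *v z\<close> is a
  positive multiple of the displacement from \<open>x\<close> to a point of \<open>N\<close>. So the
  cone that defines the surface measure of \<open>A\<close> lies, up to the origin, in a rotated
  null set, and a law with a density does not charge \<open>A\<close>.\<close>

lemma null_cone_directions_null:
  fixes X :: "'w \<Rightarrow> 'n::{finite,linorder} rvec"
  assumes null_cone: "negligible {s *\<^sub>R (y - x) | s y. 0 \<le> s \<and> y \<in> N}"
    and X: "distributed M (restrict_space sphere_measure (half_sphere v)) X f"
    and Q: "orthogonal_matrix Q" and A: "A \<in> sets borel"
    and sub: "A \<subseteq> {u. \<exists>t>0. x + t *\<^sub>R (Q *v u) \<in> N}"
  shows "emeasure M {\<omega> \<in> space M. X \<omega> \<in> A} = 0"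
proof -
  define C where "C = {s *\<^sub>R (y - x) | s y. 0 \<le> s \<and> y \<in> N}"
  have "negligible ((\<lambda>z. transpose Q *v z) ` C)"
    by (intro negligible_differentiable_image_negligible linear_imp_differentiable_on matrix_vector_mul_linear)
      (auto simp: C_def null_cone)
  moreover have "{z \<in> ball 0 1. sgn z \<in> A} \<subseteq> insert 0 ((\<lambda>z. transpose Q *v z) ` C)"
  proof safe
    fix z assume z: "sgn z \<in> A" "z \<notin> (\<lambda>z. transpose Q *v z) ` C"
    show "z = 0"
    proof (rule ccontr)
      assume "z \<noteq> 0"
      obtain t where t: "0 < t" "x + t *\<^sub>R (Q *v sgn z) \<in> N" using z(1) sub by auto
      have "Q *v z = (norm z / t) *\<^sub>R ((x + t *\<^sub>R (Q *v sgn z)) - x)"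
        using t \<open>z \<noteq> 0\<close> by (simp add: sgn_div_norm matrix_vector_mult_scaleR)
      then have "Q *v z \<in> C" unfolding C_def using t by fastforce
      moreover have "transpose Q *v (Q *v z) = z"
        using Q by (simp add: matrix_vector_mul_assoc orthogonal_matrix)
      ultimately show False using z(2) by (metis imageI)
    qed
  qed
  ultimately have "negligible {z \<in> ball 0 1. sgn z \<in> A}"
    by (meson negligible_insert negligible_subset)
  moreover have "{z \<in> ball 0 1. sgn z \<in> A} \<in> sets borel"
    using measurable_sets_borel[OF borel_measurable_sgn A] by (auto simp: Collect_conj_eq vimage_def intro!: sets.Int)
  ultimately have "emeasure lborel {z \<in> ball 0 1. sgn z \<in> A} = 0"
    by (simp add: negligible_iff_null_sets null_sets_def emeasure_completion)
  then have "emeasure sphere_measure A = 0" using A by (simp add: emeasure_sphere_measure)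
  then have "emeasure sphere_measure (A \<inter> half_sphere v) = 0"
    using emeasure_mono[of "A \<inter> half_sphere v" A sphere_measure] A by simp
  then have null: "A \<inter> half_sphere v \<in> null_sets (restrict_space sphere_measure (half_sphere v))"
    using A by (auto simp: null_sets_def emeasure_restrict_space sets_restrict_space)
  have "{\<omega> \<in> space M. X \<omega> \<in> A} = X -` (A \<inter> half_sphere v) \<inter> space M"
    using measurable_half_sphere_density(2)[OF X] by auto
  also have "emeasure M \<dots> = (\<integral>\<^sup>+u. f u * indicator (A \<inter> half_sphere v) u \<partial>restrict_space sphere_measure (half_sphere v))"
    using null by (intro distributed_emeasure[OF X]) auto
  also have "\<dots> = (\<integral>\<^sup>+u. 0 \<partial>restrict_space sphere_measure (half_sphere v))"
    using AE_not_in[OF null] by (intro nn_integral_cong_AE) auto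
  finally show ?thesis by simp
qed

text \<open>The bound \<open>p\<close> is fixed before \<open>Q\<close> and \<open>v\<close>. For
  all of them the directions in question are pulled back into the same compact cap \<open>B\<close>,
  where \<gamma> is bounded below, and their surface measure is estimated through a ball of fixed
  size.\<close>

lemma reflection_density_ball_prob:
  fixes \<gamma> :: "'n::{finite,linorder} rvec \<Rightarrow> real"
  assumes \<gamma>: "reflection_density \<gamma>" and \<rho>: "0 < \<rho>" "\<rho> \<le> 1" and c: "0 < c" "c \<le> 1"
  shows "\<exists>p>0. \<forall>(M :: 'w measure) X (Q :: 'n sqmat) v. prob_space M \<longrightarrow>
       distributed M (restrict_space sphere_measure (half_sphere e_vec)) X (\<lambda>u. ennreal (\<gamma> u)) \<longrightarrow>
       orthogonal_matrix Q \<longrightarrow> norm v = 1 \<longrightarrow> (\<forall>u. dist v u < \<rho> \<longrightarrow> c \<le> (Q *v e_vec) \<bullet> u) \<longrightarrow>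
       p \<le> measure M {\<omega> \<in> space M. dist v (Q *v X \<omega>) < \<rho>}"
proof -
  define B where "B = {u \<in> sphere 0 1. c \<le> e_vec \<bullet> (u :: 'n rvec)}"
  have ne: "norm (e_vec :: 'n rvec) = 1" by (simp add: e_vec_def)
  have "B = sphere 0 1 \<inter> {u. e_vec \<bullet> u \<ge> c}" by (auto simp: B_def)
  then have "compact B" by (simp add: compact_Int_closed closed_halfspace_ge)
  moreover have "e_vec \<in> B" using ne c by (simp add: B_def norm_eq_1)
  moreover have Bh: "B \<subseteq> half_sphere e_vec" using c by (auto simp: B_def half_sphere_def)
  ultimately have g0: "0 < (INF u \<in> B. \<gamma> u)" using \<gamma> unfolding reflection_density_def by blast
  define g where "g = (INF u \<in> B. \<gamma> u)"
  have g: "0 < g" "\<And>u. u \<in> B \<Longrightarrow> g \<le> \<gamma> u"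
  proof -
    show "0 < g" using g0 by (simp add: g_def)
    have "bdd_below (\<gamma> ` B)" using \<gamma> Bh by (intro bdd_belowI2[of _ 0]) (auto simp: reflection_density_def)
    then show "g \<le> \<gamma> u" if "u \<in> B" for u unfolding g_def using that by (rule cINF_lower)
  qed
  \<comment> \<open>The infimum of the density on the cap times a lower bound for surface measure:
    \<open>CARD('n)\<close> is the normalisation of the surface measure, the remaining factor the
    volume of a ball of radius \<open>\<rho> / 4\<close>.\<close>
  define p where "p = g * (real CARD('n) * (unit_ball_vol (real CARD('n)) * (\<rho> / 4) ^ CARD('n)))"
  show ?thesis
  proof (intro exI[of _ p] conjI allI impI)
    show "0 < p" using g \<rho> by (simp add: p_def unit_ball_vol_pos)
    fix M :: "'w measure" and X and Q :: "'n sqmat" and v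
    assume M: "prob_space M" and X: "distributed M (restrict_space sphere_measure (half_sphere e_vec)) X (\<lambda>u. ennreal (\<gamma> u))"
      and Q: "orthogonal_matrix Q" and v: "norm v = 1" and *: "\<forall>u. dist v u < \<rho> \<longrightarrow> c \<le> (Q *v e_vec) \<bullet> u"
    note cone = *[rule_format]
    interpret prob_space M by fact
    define A where "A = {u \<in> half_sphere e_vec. dist v (Q *v u) < \<rho>}"
    have "{u. dist v (Q *v u) < \<rho>} = (\<lambda>u. Q *v u) -` ball v \<rho>" by auto
    then have "open {u. dist v (Q *v u) < \<rho>}"
      by (simp add: open_vimage linear_continuous_on matrix_vector_mul_bounded_linear)
    then have A: "A \<in> sets borel" unfolding A_def by (auto simp: Collect_conj_eq intro!: sets.Int borel_open)
    have AB: "A \<subseteq> B"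
    proof
      fix u assume "u \<in> A"
      then show "u \<in> B" using cone[of "Q *v u"] Q
        by (auto simp: A_def B_def half_sphere_def inner_orthogonal_matrix_mult)
    qed
    define w where "w = transpose Q *v v"
    have Qw: "Q *v w = v" using Q unfolding orthogonal_matrix_def w_def
      by (simp add: matrix_vector_mul_assoc del: transpose_matrix_vector)
    then have nw: "norm w = 1" using norm_orthogonal_matrix_mult[OF Q, of w] v by simp
    have dQ: "dist v (Q *v u) = dist w u" for u
      using norm_orthogonal_matrix_mult[OF Q, of "w - u"] by (simp add: dist_norm matrix_vector_mult_diff_distrib Qw)
    \<comment> \<open>For \<open>z\<close> in the small ball, \<open>2 *\<^sub>R z\<close> is within
      \<open>\<rho> / 2\<close> of the unit vector \<open>w\<close>, and \<open>sgn z\<close> is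
      within \<open>\<rho> / 2\<close> of \<open>2 *\<^sub>R z\<close>. Centring at half of
      \<open>w\<close> keeps the ball inside the unit ball and away from \<open>0\<close>.\<close>
    have sub: "ball ((1/2) *\<^sub>R w) (\<rho> / 4) \<subseteq> {z \<in> ball 0 1. sgn z \<in> A}"
    proof
      fix z assume "z \<in> ball ((1/2) *\<^sub>R w) (\<rho> / 4)"
      then have z: "norm (z - (1/2) *\<^sub>R w) < \<rho> / 4" by (simp add: dist_norm norm_minus_commute)
      have "\<bar>norm z - norm ((1/2) *\<^sub>R w)\<bar> \<le> norm (z - (1/2) *\<^sub>R w)" by (rule norm_triangle_ineq3)
      then have nz: "\<bar>norm z - 1/2\<bar> < \<rho> / 4" using z nw by simp
      then have z0: "z \<noteq> 0" using \<rho> by auto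
      have "norm (2 *\<^sub>R z - w) = 2 * norm (z - (1/2) *\<^sub>R w)"
        using norm_scaleR[of 2 "z - (1/2) *\<^sub>R w"] by (simp add: algebra_simps)
      moreover have "norm (sgn z - 2 *\<^sub>R z) = \<bar>1 - 2 * norm z\<bar>"
      proof -
        have "sgn z - 2 *\<^sub>R z = (1 - 2 * norm z) *\<^sub>R sgn z" using z0 by (simp add: sgn_div_norm algebra_simps)
        then show ?thesis using z0 by (simp add: norm_sgn)
      qed
      ultimately have "norm (sgn z - w) < \<rho>"
        using norm_triangle_ineq[of "sgn z - 2 *\<^sub>R z" "2 *\<^sub>R z - w"] z nz by (simp add: abs_if split: if_splits)
      then have d: "dist v (Q *v sgn z) < \<rho>" unfolding dQ by (simp add: dist_norm norm_minus_commute)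
      have "c \<le> e_vec \<bullet> sgn z" using cone[OF d] by (simp add: inner_orthogonal_matrix_mult[OF Q])
      then have "sgn z \<in> A" using d z0 c by (simp add: A_def half_sphere_def norm_sgn)
      moreover have "norm z < 1" using nz \<rho> by linarith
      ultimately show "z \<in> {z \<in> ball 0 1. sgn z \<in> A}" by simp
    qed
    have "ennreal (unit_ball_vol (real CARD('n)) * (\<rho> / 4) ^ CARD('n)) = emeasure lborel (ball ((1/2) *\<^sub>R w) (\<rho> / 4))"
      using \<rho> by (simp add: emeasure_ball)
    also have "\<dots> \<le> emeasure lborel {z \<in> ball 0 1. sgn z \<in> A}"
      using measurable_sets_borel[OF borel_measurable_sgn A]
      by (intro emeasure_mono[OF sub]) (auto simp: Collect_conj_eq vimage_def intro!: sets.Int)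
    finally have "ennreal (real CARD('n) * (unit_ball_vol (real CARD('n)) * (\<rho> / 4) ^ CARD('n))) \<le> emeasure sphere_measure A"
      using \<rho> A by (simp add: emeasure_sphere_measure ennreal_mult ennreal_of_nat_eq_real_of_nat mult_left_mono)
    then have "ennreal p \<le> ennreal g * emeasure sphere_measure A"
      using g(1) \<rho> by (simp add: p_def ennreal_mult mult_left_mono)
    also have "emeasure sphere_measure A = emeasure (restrict_space sphere_measure (half_sphere e_vec)) A"
      by (subst emeasure_restrict_space) (auto simp: A_def)
    also have "ennreal g * \<dots> = (\<integral>\<^sup>+u. ennreal g * indicator A u \<partial>restrict_space sphere_measure (half_sphere e_vec))"
      using A by (subst nn_integral_cmult_indicator) (auto simp: A_def sets_restrict_space_iff)
    also have "\<dots> \<le> (\<integral>\<^sup>+u. ennreal (\<gamma> u) * indicator A u \<partial>restrict_space sphere_measure (half_sphere e_vec))"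
      using g(2) AB by (intro nn_integral_mono) (auto simp: indicator_def intro!: ennreal_leI)
    also have "\<dots> = emeasure M (X -` A \<inter> space M)"
      using A by (intro distributed_emeasure[OF X, symmetric]) (auto simp: A_def sets_restrict_space_iff)
    also have "X -` A \<inter> space M = {\<omega> \<in> space M. dist v (Q *v X \<omega>) < \<rho>}"
      using measurable_half_sphere_density(2)[OF X] by (auto simp: A_def)
    finally show "p \<le> measure M {\<omega> \<in> space M. dist v (Q *v X \<omega>) < \<rho>}"
      by (simp add: emeasure_eq_measure)
  qed
qed

section \<open>Flight times and measurability\<close>

lemma flight_time_less_iff:
  "flight_time D x u < y \<longleftrightarrow> (\<exists>t>0. x + t *\<^sub>R u \<in> frontier D \<and> ereal t < y)"
  unfolding flight_time_def Inf_less_iff by blast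

lemma flight_time_nonneg: "0 \<le> flight_time D x u"
  unfolding flight_time_def by (auto intro!: Inf_greatest)

lemma flight_time_geI:
  "(\<And>t. 0 < t \<Longrightarrow> t < \<epsilon> \<Longrightarrow> x + t *\<^sub>R u \<notin> frontier D) \<Longrightarrow> ereal \<epsilon> \<le> flight_time D x u"
  unfolding flight_time_def by (intro Inf_greatest) (auto simp: not_less[symmetric])

text \<open>The infimum is a limit of times at which the line meets the closed frontier. This
  includes \<open>r = 0\<close>, where such times accumulate at the start.\<close>

lemma flight_time_endpoint_in_frontier:
  assumes "flight_time D x u = ereal r" "x \<in> frontier D"
  shows "x + r *\<^sub>R u \<in> frontier D"
proof -
  have "\<exists>t. x + t *\<^sub>R u \<in> frontier D \<and> r \<le> t \<and> t < r + 1 / Suc n" for n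
  proof -
    have "flight_time D x u < ereal (r + 1 / Suc n)" using assms(1) by simp
    then obtain t where t: "0 < t" "x + t *\<^sub>R u \<in> frontier D" "t < r + 1 / Suc n"
      unfolding flight_time_less_iff ereal_less_eq less_ereal.simps by blast
    have "flight_time D x u \<le> ereal t" unfolding flight_time_def using t by (intro Inf_lower) blast
    then have "r \<le> t" using assms(1) by simp
    then show ?thesis using t by blast
  qed
  then obtain t where t: "\<And>n. x + t n *\<^sub>R u \<in> frontier D" "\<And>n. r \<le> t n" "\<And>n. t n < r + 1 / Suc n" by metis
  have "t \<longlonglongrightarrow> r"
  proof (rule tendsto_sandwich[of "\<lambda>_. r"])
    show "(\<lambda>n. r + 1 / real (Suc n)) \<longlonglongrightarrow> r" 
      using tendsto_add[OF tendsto_const LIMSEQ_Suc[OF lim_1_over_n], of r] by (simp only: add_0_right)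
  qed (intro always_eventually allI less_imp_le t tendsto_const)+
  then have "(\<lambda>n. x + t n *\<^sub>R u) \<longlonglongrightarrow> x + r *\<^sub>R u" by (intro tendsto_intros)
  then show ?thesis by (rule closed_sequentially[OF frontier_closed t(1)])
qed

text \<open>For a fixed compact time interval, the pairs that hit the frontier during it are the
  projection of a closed set along a compact factor, hence closed. Rational intervals make each
  strict sublevel set a countable union of such sets; a positive left end keeps a start on the
  frontier from counting as a hit.\<close>

lemma borel_measurable_flight_time:
  fixes D :: "'a::euclidean_space set"
  shows "(\<lambda>z. flight_time D (fst z) (snd z)) \<in> borel_measurable (borel \<Otimes>\<^sub>M borel)"
  unfolding borel_prod
proof (rule borel_measurableI_less)
  fix y :: ereal
  define G where "G ab = {z :: 'a \<times> 'a. \<exists>t. t \<in> {real_of_rat (fst ab)..real_of_rat (snd ab)} \<and>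
      (t, z) \<in> {(t, z). fst z + t *\<^sub>R snd z \<in> frontier D}}" for ab
  have "closed ((\<lambda>p :: real \<times> 'a \<times> 'a. fst (snd p) + fst p *\<^sub>R snd (snd p)) -` frontier D)"
    by (intro closed_vimage frontier_closed continuous_intros)
  then have "closed {(t, z :: 'a \<times> 'a). fst z + t *\<^sub>R snd z \<in> frontier D}"
    by (simp add: vimage_def case_prod_beta')
  then have "closed (G ab)" for ab unfolding G_def by (intro closed_compact_projection) auto
  then have "(\<Union>ab\<in>{ab. 0 < fst ab \<and> ereal (real_of_rat (snd ab)) < y}. G ab) \<in> sets borel"
    by (intro sets.countable_UN'') auto
  moreover have "{z. flight_time D (fst z) (snd z) < y} = (\<Union>ab\<in>{ab. 0 < fst ab \<and> ereal (real_of_rat (snd ab)) < y}. G ab)"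
  proof safe
    fix x u assume "flight_time D (fst (x, u)) (snd (x, u)) < y"
    then obtain t where t: "0 < t" "x + t *\<^sub>R u \<in> frontier D" "ereal t < y"
      by (auto simp: flight_time_less_iff)
    obtain a where a: "0 < real_of_rat a" "real_of_rat a < t" using of_rat_dense[OF t(1)] by blast
    obtain b' where b': "t < b'" "ereal b' < y" using ereal_dense2[OF t(3)] by auto
    obtain b where b: "t < real_of_rat b" "real_of_rat b < b'" using of_rat_dense[OF b'(1)] by blast
    have "ereal (real_of_rat b) < y" using b b' by (meson ereal_less_eq(3) less_imp_le order_le_less_trans)
    then show "(x, u) \<in> (\<Union>ab\<in>{ab. 0 < fst ab \<and> ereal (real_of_rat (snd ab)) < y}. G ab)"
      using a b t by (intro UN_I[of "(a, b)"]) (auto simp: G_def intro!: exI[of _ t])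
  next
    fix z a b assume *: "z \<in> G (a, b)" "0 < fst (a, b)" "ereal (real_of_rat (snd (a, b))) < y"
    then obtain t where "real_of_rat a \<le> t" "t \<le> real_of_rat b" "fst z + t *\<^sub>R snd z \<in> frontier D" by (auto simp: G_def)
    moreover from this have "0 < t" using * by (smt (verit) fst_conv zero_less_of_rat_iff)
    moreover have "ereal t < y" using * calculation by (metis ereal_less_eq(3) order_le_less_trans snd_conv)
    ultimately show "flight_time D (fst z) (snd z) < y" by (auto simp: flight_time_less_iff)
  qed
  ultimately show "{x \<in> space borel. flight_time D (fst x) (snd x) < y} \<in> sets borel" by simp
qed

lemma borel_measurable_matrix_vector_mult:
  "(\<lambda>z. fst z *v snd z) \<in> borel_measurable (borel \<Otimes>\<^sub>M (borel :: (real ^ 'n) measure))"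
proof -
  have "continuous_on UNIV (\<lambda>z :: (real ^ 'n ^ 'm) \<times> (real ^ 'n). fst z *v snd z)"
    unfolding matrix_vector_mult_def by (intro continuous_intros)
  then show ?thesis unfolding borel_prod by (rule borel_measurable_continuous_onI)
qed

text \<open>Continuity means oscillation zero. Each \<open>G k\<close> is the union of the open sets
  on which the values of \<open>f\<close> over \<open>S\<close> differ by less than
  \<open>1 / (k + 1)\<close>, so the set is \<open>S\<close> intersected with a countable
  intersection of open sets.\<close>

lemma borel_continuity_set:
  fixes f :: "'a::metric_space \<Rightarrow> 'b::metric_space"
  assumes "S \<in> sets borel"
  shows "{x \<in> S. continuous (at x within S) f} \<in> sets borel"
proof -
  define G where "G k = \<Union>{O'. open O' \<and> (\<forall>y \<in> O' \<inter> S. \<forall>z \<in> O' \<inter> S. dist (f y) (f z) < 1 / real (Suc k))}" for k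
  have "{x \<in> S. continuous (at x within S) f} = S \<inter> (\<Inter>k. G k)"
  proof (intro set_eqI iffI; clarsimp)
    fix x k assume x: "x \<in> S" "continuous (at x within S) f"
    have "0 < 1 / (2 * real (Suc k))" by simp
    then obtain d where d: "0 < d" "\<And>y. y \<in> S \<Longrightarrow> dist y x < d \<Longrightarrow> dist (f y) (f x) < 1 / (2 * real (Suc k))"
      using x(2) unfolding continuous_within_eps_delta by meson
    have "dist (f y) (f z) < 1 / real (Suc k)" if "y \<in> ball x d \<inter> S" "z \<in> ball x d \<inter> S" for y z
    proof -
      have "dist (f y) (f x) < 1 / (2 * real (Suc k))" "dist (f z) (f x) < 1 / (2 * real (Suc k))"
        using that d(2)[of y] d(2)[of z] by (simp_all add: dist_commute)
      then have "dist (f y) (f z) < 1 / (2 * real (Suc k)) + 1 / (2 * real (Suc k))"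
        using dist_triangle2[of "f y" "f z" "f x"] by linarith
      then show ?thesis by (simp add: field_simps)
    qed
    then show "x \<in> G k" unfolding G_def using d(1) by (intro UnionI[of "ball x d"]) auto
  next
    fix x assume x: "x \<in> S" "\<forall>k. x \<in> G k"
    show "continuous (at x within S) f" unfolding continuous_within_eps_delta
    proof (intro allI impI)
      fix e :: real assume "0 < e"
      then obtain k where k: "1 / real (Suc k) < e" by (rule nat_approx_posE)
      obtain O' where O': "open O'" "x \<in> O'" "\<forall>y \<in> O' \<inter> S. \<forall>z \<in> O' \<inter> S. dist (f y) (f z) < 1 / real (Suc k)"
        using x(2) unfolding G_def by blast
      obtain d where d: "0 < d" "ball x d \<subseteq> O'" using O' openE by blast
      have "dist (f x') (f x) < e" if "x' \<in> S" "dist x' x < d" for x'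
      proof -
        have "x' \<in> O' \<inter> S" "x \<in> O' \<inter> S" using that d O'(2) x(1) by (auto simp: dist_commute)
        then have "dist (f x') (f x) < 1 / real (Suc k)" using O'(3) by blast
        then show ?thesis using k by (rule less_trans)
      qed
      then show "\<exists>d>0. \<forall>x'\<in>S. dist x' x < d \<longrightarrow> dist (f x') (f x) < e"
        using d(1) by blast
    qed
  qed
  moreover have "G k \<in> sets borel" for k unfolding G_def by (intro borel_open open_Union) blast
  then have "(\<Inter>k. G k) \<in> sets borel" by (intro sets.countable_INT'') simp_all
  ultimately show ?thesis using assms by (metis sets.Int)
qed

lemma good_points_subset: "good_points D Rt \<gamma> U \<subseteq> Rt"
  by (auto simp: good_points_def)

lemma good_points_borel:
  assumes "regular_boundary_part D Rt"
  shows "Rt \<subseteq> frontier D" "good_points D Rt \<gamma> U \<in> sets borel"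
proof -
  from assms obtain T where T: "open T" "Rt = frontier D \<inter> T"
    unfolding regular_boundary_part_def openin_open by blast
  then show "Rt \<subseteq> frontier D" by auto
  have F: "frontier D \<in> sets borel" by (intro borel_closed frontier_closed)
  have Rt: "Rt \<in> sets borel" unfolding T(2) by (intro sets.Int F borel_open T(1))
  have "{x \<in> Rt. continuous (at x within frontier D) U} = Rt \<inter> {x \<in> frontier D. continuous (at x within frontier D) U}"
    using T by auto
  then show "good_points D Rt \<gamma> U \<in> sets borel"
    using Rt borel_continuity_set[OF F, of U] by (simp add: good_points_def)
qed

section \<open>Chains driven by independent variables\<close>

text \<open>Under independence the joint law is a product, so the probability is the integral, over
  the law of \<open>Y\<close>, of the probabilities of sections; these are at most \<open>c\<close>
  on \<open>C\<close> and do not count elsewhere.\<close>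

lemma (in prob_space) indep_var_section_le:
  assumes ind: "indep_var S Y T Z" and C: "C \<in> sets S" and A: "A \<in> sets (S \<Otimes>\<^sub>M T)" and "0 \<le> c"
    and le: "\<And>y. y \<in> C \<Longrightarrow> prob {\<omega> \<in> space M. (y, Z \<omega>) \<in> A} \<le> c"
  shows "prob {\<omega> \<in> space M. Y \<omega> \<in> C \<and> (Y \<omega>, Z \<omega>) \<in> A} \<le> c * prob {\<omega> \<in> space M. Y \<omega> \<in> C}"
proof -
  have Y [measurable]: "Y \<in> measurable M S" and Z [measurable]: "Z \<in> measurable M T"
    and J: "distr M S Y \<Otimes>\<^sub>M distr M T Z = distr M (S \<Otimes>\<^sub>M T) (\<lambda>\<omega>. (Y \<omega>, Z \<omega>))"
    using ind by (auto simp: indep_var_distribution_eq)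
  interpret Z: prob_space "distr M T Z" by (rule prob_space_distr) fact
  note [measurable] = C A
  define B where "B = {z \<in> space (S \<Otimes>\<^sub>M T). fst z \<in> C \<and> z \<in> A}"
  have B [measurable]: "B \<in> sets (S \<Otimes>\<^sub>M T)" unfolding B_def by measurable
  have "emeasure M {\<omega> \<in> space M. Y \<omega> \<in> C \<and> (Y \<omega>, Z \<omega>) \<in> A} = emeasure (distr M (S \<Otimes>\<^sub>M T) (\<lambda>\<omega>. (Y \<omega>, Z \<omega>))) B"
    using measurable_space[OF Y] measurable_space[OF Z]
    by (subst emeasure_distr) (auto simp: B_def space_pair_measure intro!: arg_cong[where f="emeasure M"])
  also have "\<dots> = (\<integral>\<^sup>+y. emeasure (distr M T Z) (Pair y -` B) \<partial>distr M S Y)"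
    unfolding J[symmetric] by (rule Z.emeasure_pair_measure_alt) simp
  also have "\<dots> \<le> (\<integral>\<^sup>+y. ennreal c * indicator C y \<partial>distr M S Y)"
  proof (rule nn_integral_mono)
    fix y assume "y \<in> space (distr M S Y)"
    then have y: "y \<in> space S" by simp
    show "emeasure (distr M T Z) (Pair y -` B) \<le> ennreal c * indicator C y"
    proof (cases "y \<in> C")
      case True
      have "emeasure (distr M T Z) (Pair y -` B) = emeasure M {\<omega> \<in> space M. (y, Z \<omega>) \<in> A}"
        using y True measurable_space[OF Z] sets.sets_into_space[OF A]
        by (subst emeasure_distr) (auto simp: B_def space_pair_measure sets_Pair1[OF B, unfolded B_def] intro!: arg_cong[where f="emeasure M"])
      also have "\<dots> \<le> ennreal c" using le[OF True] by (simp add: emeasure_eq_measure ennreal_leI)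
      finally show ?thesis using True by simp
    qed (simp add: B_def vimage_def)
  qed
  also have "\<dots> = ennreal c * emeasure (distr M S Y) C" by (rule nn_integral_cmult_indicator) simp
  also have "emeasure (distr M S Y) C = emeasure M {\<omega> \<in> space M. Y \<omega> \<in> C}"
    by (subst emeasure_distr) (auto intro!: arg_cong[where f="emeasure M"])
  finally show ?thesis using \<open>0 \<le> c\<close> by (simp add: emeasure_eq_measure ennreal_mult[symmetric])
qed

text \<open>The state at time \<open>n\<close> is a function of the inputs before \<open>n\<close>.
  Hence the event for the first \<open>m\<close> steps and the next state depend on the past block
  only, the next input is independent of that block, and each further step costs a factor
  \<open>c\<close>.\<close>

lemma (in prob_space) prob_driven_chain_le_power:
  fixes X :: "nat \<Rightarrow> (nat \<Rightarrow> 'b) \<Rightarrow> 'c"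
  assumes ind: "indep_vars (\<lambda>_. N) \<eta> UNIV"
    and X: "\<And>n. X n \<in> measurable (PiM {..<n} (\<lambda>_. N)) S"
    and A: "A \<in> sets (S \<Otimes>\<^sub>M N)" and "0 \<le> c"
    and le: "\<And>n x. x \<in> space S \<Longrightarrow> prob {\<omega> \<in> space M. (x, \<eta> n \<omega>) \<in> A} \<le> c"
  shows "prob {\<omega> \<in> space M. \<forall>n \<in> {k..<k + m}. (X n (\<lambda>i\<in>{..<n}. \<eta> i \<omega>), \<eta> n \<omega>) \<in> A} \<le> c ^ m"
proof (induction m)
  case (Suc m)
  define j where "j = k + m"
  let ?S = "PiM {..<j} (\<lambda>_. N)"
  let ?T = "PiM {j} (\<lambda>_. N)"
  define Y where "Y \<omega> = (\<lambda>i\<in>{..<j}. \<eta> i \<omega>)" for \<omega>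
  define Z where "Z \<omega> = (\<lambda>i\<in>{j}. \<eta> i \<omega>)" for \<omega>
  have indj: "indep_var ?S Y ?T Z"
    unfolding Y_def Z_def using indep_var_restrict[OF ind, of "{..<j}" "{j}"] by simp
  have meas: "X n \<circ> (\<lambda>y. restrict y {..<n}) \<in> measurable ?S S" if "n \<le> j" for n
    using that by (intro measurable_comp[OF measurable_restrict_subset X]) auto
  \<comment> \<open>The event for the first \<open>m\<close> steps as a set of past blocks;
    \<open>restrict\<close> lets all earlier states be read off from the one block of length
    \<open>j\<close>.\<close>
  define C where "C = {y \<in> space ?S. \<forall>n \<in> {k..<j}. (X n (restrict y {..<n}), y n) \<in> A}"
  have C: "C \<in> sets ?S" unfolding C_def
  proof (rule sets.sets_Collect_finite_All)
    fix n assume n: "n \<in> {k..<j}"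
    have "(\<lambda>y. (X n (restrict y {..<n}), y n)) \<in> measurable ?S (S \<Otimes>\<^sub>M N)"
      using n meas[of n] by (intro measurable_Pair measurable_component_singleton) (auto simp: o_def)
    from measurable_sets[OF this A] show "{y \<in> space ?S. (X n (restrict y {..<n}), y n) \<in> A} \<in> sets ?S"
      by (simp add: vimage_def Int_def conj_commute)
  qed simp
  define B where "B = {z \<in> space (?S \<Otimes>\<^sub>M ?T). (X j (fst z), snd z j) \<in> A}"
  have "(\<lambda>z. (X j (fst z), snd z j)) \<in> measurable (?S \<Otimes>\<^sub>M ?T) (S \<Otimes>\<^sub>M N)"
    by (intro measurable_Pair measurable_compose[OF measurable_fst X]
        measurable_compose[OF measurable_snd measurable_component_singleton]) simp
  from measurable_sets[OF this A] have B: "B \<in> sets (?S \<Otimes>\<^sub>M ?T)"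
    by (simp add: B_def vimage_def Int_def conj_commute)
  have Y: "Y \<in> measurable M ?S" and Z: "Z \<in> measurable M ?T"
    using indj by (auto simp: indep_var_distribution_eq)
  have Yr: "restrict (Y \<omega>) {..<n} = (\<lambda>i\<in>{..<n}. \<eta> i \<omega>)" if "n \<le> j" for \<omega> n
    using that by (auto simp: Y_def fun_eq_iff)
  have YC: "{\<omega> \<in> space M. Y \<omega> \<in> C} = {\<omega> \<in> space M. \<forall>n \<in> {k..<k + m}. (X n (\<lambda>i\<in>{..<n}. \<eta> i \<omega>), \<eta> n \<omega>) \<in> A}"
    using measurable_space[OF Y] by (auto simp: C_def j_def[symmetric] Yr) (auto simp: Y_def)
  have "{\<omega> \<in> space M. \<forall>n \<in> {k..<k + Suc m}. (X n (\<lambda>i\<in>{..<n}. \<eta> i \<omega>), \<eta> n \<omega>) \<in> A}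
      = {\<omega> \<in> space M. (\<forall>n \<in> {k..<k + m}. (X n (\<lambda>i\<in>{..<n}. \<eta> i \<omega>), \<eta> n \<omega>) \<in> A) \<and> (X j (Y \<omega>), \<eta> j \<omega>) \<in> A}"
    by (auto simp: j_def Y_def less_Suc_eq)
  also have "\<dots> = {\<omega> \<in> space M. Y \<omega> \<in> C \<and> (Y \<omega>, Z \<omega>) \<in> B}"
    using YC measurable_space[OF Y] measurable_space[OF Z] by (auto simp: B_def space_pair_measure Z_def)
  also have "prob \<dots> \<le> c * prob {\<omega> \<in> space M. Y \<omega> \<in> C}"
  proof (rule indep_var_section_le[OF indj C B \<open>0 \<le> c\<close>])
    fix y assume "y \<in> C"
    then have "y \<in> space ?S" by (simp add: C_def)
    then have "{\<omega> \<in> space M. (y, Z \<omega>) \<in> B} = {\<omega> \<in> space M. (X j y, \<eta> j \<omega>) \<in> A}"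
      using measurable_space[OF Z] by (auto simp: B_def space_pair_measure Z_def)
    then show "prob {\<omega> \<in> space M. (y, Z \<omega>) \<in> B} \<le> c"
      using le measurable_space[OF X] \<open>y \<in> space ?S\<close> by simp
  qed
  also have "\<dots> \<le> c * c ^ m" unfolding YC using Suc.IH \<open>0 \<le> c\<close> by (rule mult_left_mono)
  finally show ?case unfolding power_Suc .
qed simp

text \<open>
  A surrogate for \<^const>\<open>walk\<close> without extra states: it starts afresh at \<open>x0\<close> whenever the walk
  would leave \<open>R\<close>, hence is an \<open>R\<close>-valued Markov chain, and agrees with the walk up to that time.
\<close>

primrec restarted_walk ::
  "'n::finite rvec set \<Rightarrow> 'n rvec set \<Rightarrow> ('n rvec \<Rightarrow> 'n sqmat) \<Rightarrow> 'n rvec \<Rightarrow>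
     (nat \<Rightarrow> 'n rvec) \<Rightarrow> nat \<Rightarrow> 'n rvec" where
  "restarted_walk D R U x0 \<omega> 0 = x0"
| "restarted_walk D R U x0 \<omega> (Suc n) =
     (case hit D (restarted_walk D R U x0 \<omega> n) (U (restarted_walk D R U x0 \<omega> n) *v \<omega> n) of
        At y \<Rightarrow> if y \<in> R then y else x0
      | _ \<Rightarrow> x0)"

lemma restarted_walk_in: "x0 \<in> R \<Longrightarrow> restarted_walk D R U x0 \<omega> n \<in> R"
  by (cases n) (auto split: walk_state.split)

lemma restarted_walk_cong:
  "(\<And>i. i < n \<Longrightarrow> \<omega> i = \<omega>' i) \<Longrightarrow> restarted_walk D R U x0 \<omega> n = restarted_walk D R U x0 \<omega>' n"
proof (induction n)
  case (Suc n)
  then have "restarted_walk D R U x0 \<omega> n = restarted_walk D R U x0 \<omega>' n" by simp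
  then show ?case using Suc.prems[of n] by simp
qed simp

text \<open>While every hit point is good, both recursions take the same branch. The first restart
  can then only come from a flight to infinity, after which the walk remains in
  \<open>Escaped\<close>.\<close>

lemma walk_eq_restarted_walk:
  fixes D R U x0 \<omega>
  defines "X \<equiv> restarted_walk D R U x0 \<omega>"
  assumes "x0 \<in> R" and ok: "\<And>n y. hit D (X n) (U (X n) *v \<omega> n) = At y \<Longrightarrow> y \<in> R"
  shows "walk D R U x0 \<omega> n \<in> {At (X n), Escaped}"
proof (induction n)
  case (Suc n)
  have XR: "X n \<in> R" unfolding X_def using \<open>x0 \<in> R\<close> by (rule restarted_walk_in)
  have S: "X (Suc n) = (case hit D (X n) (U (X n) *v \<omega> n) of At y \<Rightarrow> if y \<in> R then y else x0 | _ \<Rightarrow> x0)"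
    by (simp add: X_def)
  have nC: "hit D a b \<noteq> Cemetery" for a b by (simp add: hit_def)
  show ?case
  proof (cases "walk D R U x0 \<omega> n = Escaped")
    case False
    then have W: "walk D R U x0 \<omega> (Suc n) = hit D (X n) (U (X n) *v \<omega> n)" using Suc XR by auto
    show ?thesis
    proof (cases "hit D (X n) (U (X n) *v \<omega> n)")
      case (At y)
      then show ?thesis unfolding W S using ok[OF At] by simp
    qed (use nC W in \<open>simp_all del: walk.simps\<close>)
  qed simp
qed (simp add: X_def)

section \<open>Divergence along a single trajectory\<close>

lemma nonneg_partial_sums_tendsto_infinity:
  fixes r :: "nat \<Rightarrow> real"
  assumes r: "\<And>n. 0 \<le> r n" and "\<not> summable r"
  shows "(\<lambda>n. ereal (\<Sum>i<n. r i)) \<longlonglongrightarrow> \<infinity>"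
  unfolding tendsto_PInfty
proof
  fix c
  have "\<exists>N. c < (\<Sum>i<N. r i)"
  proof (rule ccontr)
    assume "\<not> ?thesis"
    then have "summable r" using r by (intro summableI_nonneg_bounded[of r c]) (auto simp: not_less)
    then show False using assms(2) by simp
  qed
  then obtain N where N: "c < (\<Sum>i<N. r i)" by blast
  have "c < (\<Sum>i<n. r i)" if "N \<le> n" for n
    using N sum_mono2[of "{..<n}" "{..<N}" r] that r by (auto intro: less_le_trans)
  then show "\<forall>\<^sub>F n in sequentially. ereal c < ereal (\<Sum>i<n. r i)"
    by (auto simp: eventually_sequentially)
qed

text \<open>The pathwise half of the argument: randomness is confined to \<open>ok\<close>,
  \<open>unit\<close> and \<open>leave\<close>. An infinite leg makes all later sums infinite;
  without one the walk never escapes and coincides with its surrogate.\<close>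

lemma hitting_time_tendsto_infinity:
  fixes D R :: "'n::finite rvec set" and U x0 \<omega>
  defines "X \<equiv> restarted_walk D R U x0 \<omega>"
  assumes x0: "x0 \<in> R" and R: "R \<subseteq> frontier D"
    and ok: "\<And>n y. hit D (X n) (U (X n) *v \<omega> n) = At y \<Longrightarrow> y \<in> R"
    and unit: "\<And>n. norm (U (X n) *v \<omega> n) = 1"
    and cover: "frontier D \<subseteq> (\<Union>x\<in>C. ball x (e x))"
    and leave: "\<And>x k. x \<in> C \<Longrightarrow> \<exists>n\<ge>k. \<not> (X n \<in> ball x (e x) \<and> flight_time D (X n) (U (X n) *v \<omega> n) < ereal (e x))"
  shows "hitting_time D R U x0 \<omega> \<longlonglongrightarrow> \<infinity>"
proof (cases "\<exists>n. leg_time D R U x0 \<omega> n = \<infinity>")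
  case True
  then obtain n where n: "leg_time D R U x0 \<omega> n = \<infinity>" by blast
  have "hitting_time D R U x0 \<omega> m = \<infinity>" if "n < m" for m
    using n that unfolding hitting_time_def by (subst sum_Pinfty) auto
  then have "\<forall>\<^sub>F m in sequentially. hitting_time D R U x0 \<omega> m = \<infinity>"
    by (rule eventually_mono[OF eventually_gt_at_top[of n]])
  then show ?thesis by (rule tendsto_eventually)
next
  case False
  have XR: "X n \<in> R" for n unfolding X_def using x0 by (rule restarted_walk_in)
  have wX: "walk D R U x0 \<omega> n = At (X n)" for n
  proof -
    have "leg_time D R U x0 \<omega> n \<noteq> \<infinity>" using False by blast
    then have "walk D R U x0 \<omega> n \<noteq> Escaped" by (auto simp: leg_time_def)
    then show ?thesis using walk_eq_restarted_walk[of x0 R D U \<omega> n] x0 ok unfolding X_def by blast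
  qed
  define u where "u n = U (X n) *v \<omega> n" for n
  have leg: "leg_time D R U x0 \<omega> n = flight_time D (X n) (u n)" for n
    using XR by (simp add: leg_time_def wX u_def)
  define r where "r n = real_of_ereal (flight_time D (X n) (u n))" for n
  have fin: "flight_time D (X n) (u n) = ereal (r n)" for n
  proof -
    have "flight_time D (X n) (u n) \<noteq> \<infinity>" using False by (simp add: leg)
    then show ?thesis using flight_time_nonneg[of D "X n" "u n"]
      unfolding r_def by (simp add: ereal_real)
  qed
  have r0: "0 \<le> r n" for n using flight_time_nonneg[of D "X n" "u n"] by (simp add: fin)
  have step: "X (Suc n) = X n + r n *\<^sub>R u n" for n
  proof -
    have "At (X (Suc n)) = walk D R U x0 \<omega> (Suc n)" by (rule wX[symmetric])
    also have "\<dots> = hit D (X n) (u n)" by (simp add: wX XR u_def)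
    also have "\<dots> = At (X n + r n *\<^sub>R u n)" by (simp add: hit_def fin)
    finally show ?thesis by simp
  qed
  have "\<not> summable r"
  proof
    assume s: "summable r"
    have nu: "norm (u n) = 1" for n unfolding u_def by (rule unit)
    \<comment> \<open>Unit speed turns summable flight times into absolutely summable
      displacements.\<close>
    have "norm (X (Suc n) - X n) = r n" for n
      unfolding step add_diff_cancel_left' norm_scaleR nu using r0[of n] by simp
    then have "summable (\<lambda>n. norm (X (Suc n) - X n))" using s by (simp only:)
    then have "summable (\<lambda>n. X (Suc n) - X n)" by (rule summable_norm_cancel)
    then have "(\<lambda>n. \<Sum>i<n. X (Suc i) - X i) \<longlonglongrightarrow> (\<Sum>n. X (Suc n) - X n)" by (rule summable_LIMSEQ)
    then have "(\<lambda>n. X n - X 0 + X 0) \<longlonglongrightarrow> (\<Sum>n. X (Suc n) - X n) + X 0"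
      unfolding sum_lessThan_telescope by (intro tendsto_intros)
    then have "X \<longlonglongrightarrow> (\<Sum>n. X (Suc n) - X n) + X 0" unfolding diff_add_cancel .
    then obtain x where x: "X \<longlonglongrightarrow> x" by blast
    have "X n \<in> frontier D" for n using XR R by blast
    then have "x \<in> frontier D" using x by (rule closed_sequentially[OF frontier_closed])
    then obtain y where y: "y \<in> C" "x \<in> ball y (e y)" using cover by blast
    then have "0 < e y" by (auto intro: le_less_trans[OF zero_le_dist])
    have "\<forall>\<^sub>F n in sequentially. X n \<in> ball y (e y)" using x open_ball y(2) by (rule topological_tendstoD)
    moreover have "\<forall>\<^sub>F n in sequentially. r n < e y"
      using summable_LIMSEQ_zero[OF s] \<open>0 < e y\<close> by (rule order_tendstoD)
    ultimately have "\<forall>\<^sub>F n in sequentially. X n \<in> ball y (e y) \<and> r n < e y" by (rule eventually_conj)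
    then obtain k where "\<And>n. k \<le> n \<Longrightarrow> X n \<in> ball y (e y) \<and> r n < e y"
      unfolding eventually_sequentially by blast
    then show False using leave[OF y(1), of k] unfolding u_def[symmetric] fin less_ereal.simps by blast
  qed
  with r0 have "(\<lambda>n. ereal (\<Sum>i<n. r i)) \<longlonglongrightarrow> \<infinity>" by (rule nonneg_partial_sums_tendsto_infinity)
  then show ?thesis by (simp add: hitting_time_def[abs_def] leg fin)
qed

section \<open>The reflected walk as a Markov chain\<close>

locale reflected_walk = prob_space M
  for M :: "'w measure"
    and D Rt :: "'n::{finite,linorder} rvec set"
    and \<gamma> :: "'n rvec \<Rightarrow> real"
    and U :: "'n rvec \<Rightarrow> 'n sqmat"
    and x0 :: "'n rvec"
    and \<eta> :: "nat \<Rightarrow> 'w \<Rightarrow> 'n rvec" +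
  assumes dim_ge_2: "2 \<le> CARD('n)"
    and open_domain: "open D"
    and lipschitz: "lipschitz_boundary D"
    and regular: "regular_boundary_part D Rt"
    and density: "reflection_density \<gamma>"
    and frames: "reflection_frames D Rt U"
    and frames_continuous: "\<not> axially_symmetric \<gamma> \<Longrightarrow> ae_continuous_frames D U"
    and start: "x0 \<in> good_points D Rt \<gamma> U"
    and indep: "indep_vars (\<lambda>_. borel) \<eta> UNIV"
    and distr: "\<And>i. distributed M (restrict_space sphere_measure (half_sphere e_vec)) (\<eta> i)
                (\<lambda>u. ennreal (\<gamma> u))"
begin

abbreviation "R \<equiv> good_points D Rt \<gamma> U"

abbreviation "state_space \<equiv> restrict_space borel R"

abbreviation "X n \<omega> \<equiv> restarted_walk D R U x0 \<omega> n"

abbreviation "flight z \<equiv> flight_time D (fst z) (U (fst z) *v snd z)"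

lemma R_subset: "R \<subseteq> frontier D" "R \<subseteq> Rt"
  using good_points_borel(1)[OF regular] good_points_subset[of D Rt \<gamma> U] by blast+

lemma space_state_space [simp]: "space state_space = R"
  by (simp add: space_restrict_space)

lemma orthogonal_frame: "x \<in> R \<Longrightarrow> orthogonal_matrix (U x)"
  using frames R_subset unfolding reflection_frames_def by blast

lemma measurable_direction:
  "(\<lambda>z. U (fst z) *v snd z) \<in> borel_measurable (state_space \<Otimes>\<^sub>M borel)"
proof -
  have "U \<in> borel_measurable state_space"
    using frames R_subset unfolding reflection_frames_def by (blast intro: measurable_restrict_mono)
  then have "(\<lambda>z. (U (fst z), snd z)) \<in> measurable (state_space \<Otimes>\<^sub>M borel) (borel \<Otimes>\<^sub>M borel)"
    by (intro measurable_Pair measurable_compose[OF measurable_fst] measurable_snd)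
  from measurable_compose[OF this borel_measurable_matrix_vector_mult] show ?thesis by simp
qed

lemma measurable_position: "fst \<in> borel_measurable (state_space \<Otimes>\<^sub>M borel)"
  by (intro measurable_compose[OF measurable_fst] measurable_restrict_space1 measurable_ident_sets) simp

lemma measurable_flight: "flight \<in> borel_measurable (state_space \<Otimes>\<^sub>M borel)"
  using measurable_compose[OF measurable_Pair[OF measurable_position measurable_direction] borel_measurable_flight_time]
  by simp

text \<open>An infinite flight is read as length \<open>0\<close>, which would give back the
  starting point; events about \<open>endpoint\<close> therefore also require
  \<open>flight z < \<infinity>\<close>.\<close>

definition "endpoint z = fst z + real_of_ereal (flight z) *\<^sub>R (U (fst z) *v snd z)"

lemma measurable_endpoint: "endpoint \<in> borel_measurable (state_space \<Otimes>\<^sub>M borel)"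
  unfolding endpoint_def using measurable_position measurable_direction measurable_flight by measurable

lemma R_borel: "R \<in> sets borel"
  by (rule good_points_borel(2)[OF regular])

text \<open>The index set may exceed \<open>{..<n}\<close> because the induction evaluates the
  earlier states on the same product space.\<close>

lemma measurable_restarted_walk:
  "{..<n} \<subseteq> I \<Longrightarrow> X n \<in> measurable (PiM I (\<lambda>_. borel)) state_space"
proof (induction n)
  case 0
  then show ?case using start by (simp add: measurable_restrict_space2_iff)
next
  case (Suc n)
  let ?z = "\<lambda>\<omega>. (X n \<omega>, \<omega> n)"
  have z: "?z \<in> measurable (PiM I (\<lambda>_. borel)) (state_space \<Otimes>\<^sub>M borel)"
    using Suc.prems by (intro measurable_Pair Suc.IH measurable_component_singleton) auto
  note [measurable] = measurable_compose[OF z measurable_endpoint] measurable_compose[OF z measurable_flight] R_borel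
  have "X (Suc n) = (\<lambda>\<omega>. if flight (?z \<omega>) < \<infinity> \<and> endpoint (?z \<omega>) \<in> R then endpoint (?z \<omega>) else x0)"
    by (auto simp: hit_def endpoint_def fun_eq_iff)
  also have "\<dots> \<in> borel_measurable (PiM I (\<lambda>_. borel))" by measurable
  finally show ?case
    using start restarted_walk_in[OF start] by (intro measurable_restrict_space2) (auto simp del: restarted_walk.simps)
qed

lemma measurable_\<eta>: "\<eta> n \<in> borel_measurable M" "\<omega> \<in> space M \<Longrightarrow> \<eta> n \<omega> \<in> half_sphere e_vec"
  using measurable_half_sphere_density[OF distr] by auto

lemma restarted_walk_restrict: "X n (\<lambda>i\<in>{..<n}. \<omega> i) = X n \<omega>"
  by (rule restarted_walk_cong) simp

lemma chain_event:
  assumes A: "A \<in> sets (state_space \<Otimes>\<^sub>M borel)"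
  shows "{\<omega> \<in> space M. (X n (\<lambda>i. \<eta> i \<omega>), \<eta> n \<omega>) \<in> A} \<in> events"
proof -
  have "(\<lambda>\<omega>. X n (\<lambda>i\<in>{..<n}. \<eta> i \<omega>)) \<in> measurable M state_space"
    by (rule measurable_compose[OF measurable_restrict measurable_restarted_walk]) (auto simp: measurable_\<eta>)
  then have "(\<lambda>\<omega>. (X n (\<lambda>i. \<eta> i \<omega>), \<eta> n \<omega>)) \<in> measurable M (state_space \<Otimes>\<^sub>M borel)"
    unfolding restarted_walk_restrict by (intro measurable_Pair measurable_\<eta>)
  from measurable_sets[OF this A] show ?thesis by (simp add: vimage_def Int_def conj_commute)
qed

lemma chain_prob_le_power:
  assumes "A \<in> sets (state_space \<Otimes>\<^sub>M borel)" "0 \<le> c"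
    and "\<And>n x. x \<in> R \<Longrightarrow> prob {\<omega> \<in> space M. (x, \<eta> n \<omega>) \<in> A} \<le> c"
  shows "prob {\<omega> \<in> space M. \<forall>n \<in> {k..<k + m}. (X n (\<lambda>i. \<eta> i \<omega>), \<eta> n \<omega>) \<in> A} \<le> c ^ m"
  using prob_driven_chain_le_power[OF indep measurable_restarted_walk[OF order_refl] assms(1,2), of k m] assms(3)
  by (simp add: restarted_walk_restrict)

lemma chain_AE_never:
  assumes A: "A \<in> sets (state_space \<Otimes>\<^sub>M borel)"
    and "\<And>n x. x \<in> R \<Longrightarrow> prob {\<omega> \<in> space M. (x, \<eta> n \<omega>) \<in> A} = 0"
  shows "AE \<omega> in M. \<forall>n. (X n (\<lambda>i. \<eta> i \<omega>), \<eta> n \<omega>) \<notin> A"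
  unfolding AE_all_countable
proof
  fix n
  have "prob {\<omega> \<in> space M. (X n (\<lambda>i. \<eta> i \<omega>), \<eta> n \<omega>) \<in> A} \<le> 0"
    \<comment> \<open>The power bound with \<open>c = 0\<close> and a single step.\<close>
    using chain_prob_le_power[OF A order_refl, of n 1] assms(2) by simp
  then have "prob {\<omega> \<in> space M. (X n (\<lambda>i. \<eta> i \<omega>), \<eta> n \<omega>) \<in> A} = 0"
    by (simp add: measure_le_0_iff)
  then show "AE \<omega> in M. (X n (\<lambda>i. \<eta> i \<omega>), \<eta> n \<omega>) \<notin> A"
    using chain_event[OF A, of n] by (intro AE_I'[of "{\<omega> \<in> space M. (X n (\<lambda>i. \<eta> i \<omega>), \<eta> n \<omega>) \<in> A}"])
      (auto simp: null_sets_def emeasure_eq_measure)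
qed

text \<open>Remaining in \<open>A\<close> from time \<open>k\<close> on means being there at
  \<open>m\<close> consecutive times for every \<open>m\<close>, which has probability at most
  \<open>c ^ m\<close>.\<close>

lemma chain_AE_leaves:
  assumes A: "A \<in> sets (state_space \<Otimes>\<^sub>M borel)" and c: "0 \<le> c" "c < 1"
    and le: "\<And>n x. x \<in> R \<Longrightarrow> prob {\<omega> \<in> space M. (x, \<eta> n \<omega>) \<in> A} \<le> c"
  shows "AE \<omega> in M. \<forall>k. \<exists>n\<ge>k. (X n (\<lambda>i. \<eta> i \<omega>), \<eta> n \<omega>) \<notin> A"
  unfolding AE_all_countable
proof
  fix k
  let ?E = "{\<omega> \<in> space M. \<forall>n\<in>{k..}. (X n (\<lambda>i. \<eta> i \<omega>), \<eta> n \<omega>) \<in> A}"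
  have E: "?E \<in> events" by (intro sets.sets_Collect_countable_Ball chain_event[OF A])
  have F: "{\<omega> \<in> space M. \<forall>n \<in> {k..<k + m}. (X n (\<lambda>i. \<eta> i \<omega>), \<eta> n \<omega>) \<in> A} \<in> events" for m
    by (intro sets.sets_Collect_finite_All chain_event[OF A]) auto
  have "prob ?E \<le> c ^ m" for m
    using chain_prob_le_power[OF A c(1) le, of k m] finite_measure_mono[OF _ F[of m], of ?E] by fastforce
  moreover have "(\<lambda>m. c ^ m) \<longlonglongrightarrow> 0" using c by (intro LIMSEQ_realpow_zero)
  ultimately have "prob ?E \<le> 0" by (intro tendsto_lowerbound[of "\<lambda>m. c ^ m"]) auto
  then have "prob ?E = 0" by (simp add: measure_le_0_iff)
  then show "AE \<omega> in M. \<exists>n\<ge>k. (X n (\<lambda>i. \<eta> i \<omega>), \<eta> n \<omega>) \<notin> A"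
    using E by (intro AE_I'[of ?E]) (auto simp: null_sets_def emeasure_eq_measure)
qed

lemma bad_cone_negligible: "negligible {s *\<^sub>R (y - x) | s y. 0 \<le> s \<and> y \<in> frontier D - R}"
proof (rule negligible_subset)
  \<comment> \<open>Discontinuities of \<open>U\<close> remove points from \<open>R\<close> only in
    the case without axial symmetry.\<close>
  define N where "N = (if axially_symmetric \<gamma> then {} else {x \<in> frontier D. \<not> continuous (at x within frontier D) U})"
  have 1: "hausdorff_measure (CARD('n) - 1) (frontier D - Rt) = 0"
    using regular by (simp add: regular_boundary_part_def)
  have 2: "hausdorff_measure (CARD('n) - 1) N = 0"
    using frames_continuous hausdorff_measure_mono[of "{}" "frontier D - Rt" "CARD('n) - 1"] 1
    by (simp add: N_def ae_continuous_frames_def)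
  show "negligible ({s *\<^sub>R (y - x) | s y. 0 \<le> s \<and> y \<in> frontier D - Rt} \<union> {s *\<^sub>R (y - x) | s y. 0 \<le> s \<and> y \<in> N})"
    using 1 2 dim_ge_2 by (intro negligible_Un hausdorff_null_negligible_cone) auto
  show "{s *\<^sub>R (y - x) | s y. 0 \<le> s \<and> y \<in> frontier D - R} \<subseteq>
      {s *\<^sub>R (y - x) | s y. 0 \<le> s \<and> y \<in> frontier D - Rt} \<union> {s *\<^sub>R (y - x) | s y. 0 \<le> s \<and> y \<in> N}"
    unfolding N_def good_points_def by (auto split: if_splits)
qed

lemma AE_hits_good_points:
  "AE \<omega> in M. \<forall>n y. hit D (X n (\<lambda>i. \<eta> i \<omega>)) (U (X n (\<lambda>i. \<eta> i \<omega>)) *v \<eta> n \<omega>) = At y \<longrightarrow> y \<in> R"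
proof -
  let ?S = "state_space \<Otimes>\<^sub>M (borel :: 'n rvec measure)"
  define B where "B = {z \<in> space ?S. flight z < \<infinity> \<and> endpoint z \<notin> R}"
  note [measurable] = measurable_endpoint measurable_flight R_borel
  have B: "B \<in> sets ?S" unfolding B_def by measurable
  have "AE \<omega> in M. \<forall>n. (X n (\<lambda>i. \<eta> i \<omega>), \<eta> n \<omega>) \<notin> B"
  proof (rule chain_AE_never[OF B])
    fix n x assume x: "x \<in> R"
    have "emeasure M {\<omega> \<in> space M. \<eta> n \<omega> \<in> Pair x -` B} = 0"
    proof (rule null_cone_directions_null[OF bad_cone_negligible[of x] distr orthogonal_frame[OF x]])
      show "Pair x -` B \<in> sets borel" using B by (rule sets_Pair1)
      show "Pair x -` B \<subseteq> {u. \<exists>t>0. x + t *\<^sub>R (U x *v u) \<in> frontier D - R}"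
      proof safe
        fix u assume "(x, u) \<in> B"
        then have b: "flight_time D x (U x *v u) < \<infinity>"
          "x + real_of_ereal (flight_time D x (U x *v u)) *\<^sub>R (U x *v u) \<notin> R"
          by (auto simp: B_def endpoint_def)
        then obtain r where r: "flight_time D x (U x *v u) = ereal r" "0 \<le> r"
          using flight_time_nonneg[of D x "U x *v u"] by (cases "flight_time D x (U x *v u)") auto
        have "x + r *\<^sub>R (U x *v u) \<in> frontier D"
          using r(1) by (rule flight_time_endpoint_in_frontier) (use x R_subset in auto)
        moreover have "x + r *\<^sub>R (U x *v u) \<notin> R" using b(2) by (simp add: r)
        \<comment> \<open>A flight of length \<open>0\<close> ends at its start, which is good; so a
          bad end point is reached at a positive time, as the null cone requires.\<close>
        moreover from this have "r \<noteq> 0" using x by auto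
        ultimately show "\<exists>t>0. x + t *\<^sub>R (U x *v u) \<in> frontier D - R" using r(2) by (intro exI[of _ r]) auto
      qed
    qed
    then show "prob {\<omega> \<in> space M. (x, \<eta> n \<omega>) \<in> B} = 0" by (simp add: measure_def)
  qed
  then show ?thesis
  proof (rule AE_mp, intro AE_I2 impI allI)
    fix \<omega> n y assume "\<omega> \<in> space M" and *: "\<forall>n. (X n (\<lambda>i. \<eta> i \<omega>), \<eta> n \<omega>) \<notin> B"
      and h: "hit D (X n (\<lambda>i. \<eta> i \<omega>)) (U (X n (\<lambda>i. \<eta> i \<omega>)) *v \<eta> n \<omega>) = At y"
    show "y \<in> R" using *[rule_format, of n] h restarted_walk_in[OF start]
      by (auto simp: B_def hit_def endpoint_def space_pair_measure split: if_splits)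
  qed
qed

section \<open>Uniform chance of a long flight and conclusion\<close>

text \<open>The geometric cone and the reflection law meet here. The same \<open>e\<close> serves as
  radius of the neighbourhood and as time threshold, and \<open>c\<close> is common to all good
  points of the neighbourhood and all times.\<close>

lemma uniform_long_flight:
  assumes x: "x \<in> frontier D"
  shows "\<exists>e>0. \<exists>c\<ge>0. c < 1 \<and> (\<forall>n. \<forall>y \<in> R \<inter> ball x e.
    prob {\<omega> \<in> space M. flight_time D y (U y *v \<eta> n \<omega>) < ereal e} \<le> c)"
proof -
  obtain v \<rho> \<epsilon> where v: "norm v = 1" "0 < \<rho>" "\<rho> \<le> 1" "0 < \<epsilon>"
    and cone: "\<And>y u t. \<lbrakk>y \<in> closure D; dist x y < \<epsilon>; dist v u < \<rho>; 0 < t; t < \<epsilon>\<rbrakk> \<Longrightarrow> y + t *\<^sub>R u \<in> D"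
    using lipschitz_boundary_uniform_cone[OF lipschitz open_domain x] by blast
  have \<rho>2: "0 < \<rho> / 2" "\<rho> / 2 \<le> 1" using v by auto
  obtain p where p: "0 < p"
    "\<forall>(M :: 'w measure) X (Q :: 'n sqmat) v. prob_space M \<longrightarrow>
       distributed M (restrict_space sphere_measure (half_sphere e_vec)) X (\<lambda>u. ennreal (\<gamma> u)) \<longrightarrow>
       orthogonal_matrix Q \<longrightarrow> norm v = 1 \<longrightarrow> (\<forall>u. dist v u < \<rho> / 2 \<longrightarrow> \<rho> / 2 \<le> (Q *v e_vec) \<bullet> u) \<longrightarrow>
       p \<le> measure M {\<omega> \<in> space M. dist v (Q *v X \<omega>) < \<rho> / 2}"
    using reflection_density_ball_prob[OF density \<rho>2 \<rho>2, where ?'w = 'w] by blast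
  \<comment> \<open>The maximum guarantees a nonnegative bound: \<open>p \<le> 1\<close> is not
    known when the ball contains no good point. Halving \<epsilon> makes room for a neighbourhood of
    \<open>y\<close> inside the one of \<open>x\<close>.\<close>
  have "prob {\<omega> \<in> space M. flight_time D y (U y *v \<eta> n \<omega>) < ereal (\<epsilon> / 2)} \<le> max 0 (1 - p)"
    if y: "y \<in> R \<inter> ball x (\<epsilon> / 2)" for n y
  proof -
    have yF: "y \<in> frontier D" and yc: "y \<in> closure D" using y R_subset by (auto simp: frontier_def)
    have Q: "orthogonal_matrix (U y)" using y by (intro orthogonal_frame) auto
    define \<nu> where "\<nu> = U y *v e_vec"
    have nu: "is_inner_normal D y \<nu>" using frames y R_subset unfolding reflection_frames_def \<nu>_def by blast
    then have nu1: "\<nu> \<bullet> \<nu> = 1" unfolding is_inner_normal_def norm_eq_1 by blast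
    have pos: "0 < \<nu> \<bullet> u" if "u \<in> ball v \<rho>" for u
    proof (rule inner_normal_cone_pos[OF open_domain nu open_ball _ _ that])
      fix y' w t assume "y' \<in> closure D" "dist y y' < \<epsilon> / 2" "w \<in> ball v \<rho>" "0 < t" "t < \<epsilon> / 2"
      moreover from this have "dist x y' < \<epsilon>" using y dist_triangle[of x y' y] by auto
      ultimately show "y' + t *\<^sub>R w \<in> D" using v by (intro cone) auto
    qed (use v in auto)
    \<comment> \<open>Moving \<open>u\<close> back by \<open>\<rho> / 2\<close> along the unit
      normal keeps it in the ball of radius \<rho>, where the inner product is still
      positive.\<close>
    have "\<rho> / 2 \<le> \<nu> \<bullet> u" if "dist v u < \<rho> / 2" for u
    proof -
      have "dist u (u - (\<rho> / 2) *\<^sub>R \<nu>) = \<rho> / 2"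
        using nu v(2) by (simp add: is_inner_normal_def dist_norm)
      then have "dist v (u - (\<rho> / 2) *\<^sub>R \<nu>) < \<rho>"
        using that dist_triangle[of v "u - (\<rho> / 2) *\<^sub>R \<nu>" u] by linarith
      then have "0 < \<nu> \<bullet> (u - (\<rho> / 2) *\<^sub>R \<nu>)" by (intro pos) simp
      then show ?thesis by (simp add: inner_diff_right nu1)
    qed
    then have P: "p \<le> prob {\<omega> \<in> space M. dist v (U y *v \<eta> n \<omega>) < \<rho> / 2}"
      unfolding \<nu>_def by (intro p(2)[rule_format] prob_space_axioms distr Q v(1))
    have "(\<lambda>\<omega>. U y *v \<eta> n \<omega>) \<in> borel_measurable M"
      by (intro measurable_compose[OF measurable_\<eta>(1)] borel_measurable_continuous_onI matrix_vector_mult_linear_continuous_on)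
    from measurable_sets[OF this, of "ball v (\<rho> / 2)"]
    have ev: "{\<omega> \<in> space M. dist v (U y *v \<eta> n \<omega>) < \<rho> / 2} \<in> events"
      by (simp add: vimage_def Int_def conj_commute)
    have "{\<omega> \<in> space M. flight_time D y (U y *v \<eta> n \<omega>) < ereal (\<epsilon> / 2)} \<subseteq>
        space M - {\<omega> \<in> space M. dist v (U y *v \<eta> n \<omega>) < \<rho> / 2}"
    proof safe
      fix \<omega> assume f: "flight_time D y (U y *v \<eta> n \<omega>) < ereal (\<epsilon> / 2)" and d: "dist v (U y *v \<eta> n \<omega>) < \<rho> / 2"
      have "ereal (\<epsilon> / 2) \<le> flight_time D y (U y *v \<eta> n \<omega>)"
      proof (rule flight_time_geI)
        fix t assume "0 < t" "t < \<epsilon> / 2"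
        then have "y + t *\<^sub>R (U y *v \<eta> n \<omega>) \<in> D" using y yc d v by (intro cone) auto
        then show "y + t *\<^sub>R (U y *v \<eta> n \<omega>) \<notin> frontier D"
          using open_domain by (simp add: frontier_def interior_open)
      qed
      then show False using f by simp
    qed
    then have "prob {\<omega> \<in> space M. flight_time D y (U y *v \<eta> n \<omega>) < ereal (\<epsilon> / 2)} \<le>
        prob (space M - {\<omega> \<in> space M. dist v (U y *v \<eta> n \<omega>) < \<rho> / 2})"
      using ev by (intro finite_measure_mono) auto
    also have "\<dots> \<le> 1 - p" unfolding prob_compl[OF ev] using P by linarith
    finally show ?thesis by simp
  qed
  then show ?thesis using v p(1) by (intro exI[of _ "\<epsilon> / 2"] conjI exI[of _ "max 0 (1 - p)"]) auto
qed

lemma AE_hitting_time_tendsto_infinity: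
  "AE \<omega> in M. hitting_time D R U x0 (\<lambda>i. \<eta> i \<omega>) \<longlonglongrightarrow> \<infinity>"
proof -
  let ?S = "state_space \<Otimes>\<^sub>M (borel :: 'n rvec measure)"
  \<comment> \<open>Bundling the conditions lets the radius and the bound be chosen together for
    each boundary point.\<close>
  define P where "P x \<epsilon> \<kappa> \<longleftrightarrow> 0 < \<epsilon> \<and> 0 \<le> \<kappa> \<and> \<kappa> < 1 \<and> (\<forall>n. \<forall>y \<in> R \<inter> ball x \<epsilon>.
    prob {\<omega> \<in> space M. flight_time D y (U y *v \<eta> n \<omega>) < ereal \<epsilon>} \<le> \<kappa>)" for x \<epsilon> \<kappa>
  have "\<exists>\<epsilon> \<kappa>. P x \<epsilon> \<kappa>" if "x \<in> frontier D" for x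
    using uniform_long_flight[OF that] unfolding P_def by blast
  then obtain e c where "\<And>x. x \<in> frontier D \<Longrightarrow> P x (e x) (c x)" by metis
  then have e: "\<And>x. x \<in> frontier D \<Longrightarrow> 0 < e x"
    and c: "\<And>x. x \<in> frontier D \<Longrightarrow> 0 \<le> c x" "\<And>x. x \<in> frontier D \<Longrightarrow> c x < 1"
    and le: "\<And>x n y. x \<in> frontier D \<Longrightarrow> y \<in> R \<inter> ball x (e x) \<Longrightarrow>
      prob {\<omega> \<in> space M. flight_time D y (U y *v \<eta> n \<omega>) < ereal (e x)} \<le> c x"
    unfolding P_def by blast+
  \<comment> \<open>Every neighbourhood contributes its own null set, so the cover is thinned to a
    countable one.\<close>
  obtain F where F: "F \<subseteq> (\<lambda>x. ball x (e x)) ` frontier D" "countable F" "\<Union>F = (\<Union>x\<in>frontier D. ball x (e x))"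
    using Lindelof[of "(\<lambda>x. ball x (e x)) ` frontier D"] open_ball by blast
  then obtain C where C: "countable C" "C \<subseteq> frontier D" "F = (\<lambda>x. ball x (e x)) ` C"
    using countable_subset_image[of F "\<lambda>x. ball x (e x)" "frontier D"] by blast
  have cover: "frontier D \<subseteq> (\<Union>x\<in>C. ball x (e x))"
    using e unfolding F(3)[unfolded C(3), simplified] by (meson UN_I centre_in_ball subsetI)
  have leave: "AE \<omega> in M. \<forall>x\<in>C. \<forall>k. \<exists>n\<ge>k. \<not> (X n (\<lambda>i. \<eta> i \<omega>) \<in> ball x (e x) \<and>
      flight_time D (X n (\<lambda>i. \<eta> i \<omega>)) (U (X n (\<lambda>i. \<eta> i \<omega>)) *v \<eta> n \<omega>) < ereal (e x))"
    unfolding AE_ball_countable[OF C(1)]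
  proof
    fix x assume "x \<in> C"
    then have x: "x \<in> frontier D" using C(2) by auto
    define A where "A = {z \<in> space ?S. fst z \<in> ball x (e x) \<and> flight z < ereal (e x)}"
    have "A = (fst -` ball x (e x) \<inter> space ?S) \<inter> (flight -` {..<ereal (e x)} \<inter> space ?S)"
      by (auto simp: A_def)
    also have "\<dots> \<in> sets ?S"
      by (intro sets.Int measurable_sets[OF measurable_position] measurable_sets[OF measurable_flight]) auto
    finally have A: "A \<in> sets ?S" .
    have "prob {\<omega> \<in> space M. (y, \<eta> n \<omega>) \<in> A} \<le> c x" if y: "y \<in> R" for n y
    proof (cases "y \<in> ball x (e x)")
      case True
      then show ?thesis using le[OF x, of y n] y by (simp add: A_def space_pair_measure)
    next
      case False
      then have empty: "{\<omega> \<in> space M. (y, \<eta> n \<omega>) \<in> A} = {}" by (auto simp: A_def)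
      show ?thesis unfolding empty using c(1)[OF x] by simp
    qed
    from chain_AE_leaves[OF A c(1,2)[OF x] this] show "AE \<omega> in M. \<forall>k. \<exists>n\<ge>k. \<not> (X n (\<lambda>i. \<eta> i \<omega>) \<in> ball x (e x) \<and>
      flight_time D (X n (\<lambda>i. \<eta> i \<omega>)) (U (X n (\<lambda>i. \<eta> i \<omega>)) *v \<eta> n \<omega>) < ereal (e x))"
      using restarted_walk_in[OF start] by (simp add: A_def space_pair_measure)
  qed
  show ?thesis using AE_hits_good_points leave AE_space
  proof eventually_elim
    case (elim \<omega>)
    show ?case
    proof (rule hitting_time_tendsto_infinity[OF start R_subset(1) _ _ cover])
      fix n
      have "\<eta> n \<omega> \<in> half_sphere e_vec" using elim by (intro measurable_\<eta>(2)) auto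
      then show "norm (U (X n (\<lambda>i. \<eta> i \<omega>)) *v \<eta> n \<omega>) = 1"
        using norm_orthogonal_matrix_mult[OF orthogonal_frame[OF restarted_walk_in[OF start]]]
        by (simp add: half_sphere_def)
    qed (use elim in auto)
  qed
qed

end

theorem proposition2p1:
  fixes D Rt :: "'n::{finite,linorder} rvec set"
    and \<gamma> :: "'n rvec \<Rightarrow> real"
    and U :: "'n rvec \<Rightarrow> 'n sqmat"
    and x0 :: "'n rvec"
    and M :: "'w measure"
    and \<eta> :: "nat \<Rightarrow> 'w \<Rightarrow> 'n rvec"
  assumes "2 \<le> CARD('n)"
    and "open D" and "connected D"
    and "lipschitz_boundary D"
    and "regular_boundary_part D Rt"
    and "reflection_density \<gamma>"
    and "reflection_frames D Rt U"
    and "\<not> axially_symmetric \<gamma> \<Longrightarrow> ae_continuous_frames D U"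
    and "x0 \<in> good_points D Rt \<gamma> U"
    and "prob_space M"
    and "prob_space.indep_vars M (\<lambda>_. borel) \<eta> UNIV"
    and "\<And>i. distributed M (restrict_space sphere_measure (half_sphere e_vec)) (\<eta> i)
                (\<lambda>u. ennreal (\<gamma> u))"
  shows "AE \<omega> in M.
           (\<lambda>n. hitting_time D (good_points D Rt \<gamma> U) U x0 (\<lambda>i. \<eta> i \<omega>) n) \<longlonglongrightarrow> \<infinity>"
proof -
  interpret prob_space M by fact
  interpret reflected_walk M D Rt \<gamma> U x0 \<eta>
    using assms by unfold_locales auto
  show ?thesis by (rule AE_hitting_time_tendsto_infinity)
qed

end
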